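(* Let $1 \leq m < n$ be integers, $k = n-m$, and $\alpha \in \mathbb{Q}$. Let $\mathrm{QH}_\alpha$ be the graded $\mathbb{Q}[q]$-algebra, with distinguished elements $\sigma_\lambda$, defined in the context. Let $\{\tau_\lambda \mid \lambda \subset m \times k\}$ be any $\mathbb{Q}[q]$-basis of $\mathrm{QH}_\alpha$ such that (1) $\tau_\lambda$ is homogeneous of degree $|\lambda|$ for each $\lambda \subset m\times k$; (2) $\tau_\lambda - \sigma_\lambda \in \langle q \rangle$ for each $\lambda \subset m \times k$, where $\langle q\rangle \subset \mathrm{QH}_\alpha$ is the ideal generated by $q$; and (3) the structure constants of $\mathrm{QH}_\alpha$ with respect to the $\mathbb{Q}$-basis $\{ q^d \tau_\lambda \mid \lambda \subset m \times k,\ d \geq 0 \}$ are non-negative; that is, in the expansions $\tau_\lambda \tau_\mu = \sum_{\nu, d} N^{\nu,d}_{\lambda,\mu}\, q^d \tau_\nu$ all the rational numbers $N^{\nu,d}_{\lambda,\mu}$ are $\geq 0$. Then $\tau_\lambda = \sigma_\lambda$ for all $\lambda \subset m \times k$.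
   Context: Partitions: a partition $\lambda = (\lambda_1 \geq \lambda_2 \geq \dots)$ has length $\ell(\lambda)$ (number of non-zero parts) and weight $|\lambda| = \sum \lambda_i$, with $\lambda_i = 0$ for $i > \ell(\lambda)$. We write $\lambda \subset m \times k$ if $\ell(\lambda) \leq m$ and $\lambda_1 \leq k$. Let $S = \mathbb{Q}[c_1,\dots,c_m]$ be the polynomial ring graded by $\deg(c_i) = i$, and set $c_0 = 1$ and $c_i = 0$ for $i<0$ or $i > m$. For $p \geq 1$ define $\sigma_p = \det(c_{1+j-i})_{1 \leq i,j \leq p} \in S$, and set $\sigma_0 = 1$ and $\sigma_p = 0$ for $p<0$. For a partition $\lambda = (\lambda_1 \geq \dots \geq \lambda_\ell \geq 0)$ define $\sigma_\lambda = \det(\sigma_{\lambda_i+j-i})_{1 \leq i,j \leq \ell}$, which is homogeneous of degree $|\lambda|$. For $\alpha \in \mathbb{Q}$ define $\mathrm{QH}_\alpha = S[q]/\langle \sigma_{k+1}, \dots, \sigma_{n-1},\ \sigma_n + (-1)^m \alpha q \rangle$. This is a graded $\mathbb{Q}[q]$-algebra with $\deg(q) = n$ and $\deg(c_p) = p$. The images of $\sigma_\lambda$ in $\mathrm{QH}_\alpha$ are also denoted $\sigma_\lambda$. *)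

theory Defs
  imports
    "HOL-Library.Poly_Mapping"
    "HOL-Algebra.QuotRing"
    "HOL-Algebra.Module"
    "HOL-Computational_Algebra.Polynomial"
    "Jordan_Normal_Form.Determinant"
begin

section \<open>Partitions\<close>

text \<open>A partition is the weakly decreasing list of its non-zero parts, so the length of the
  partition is the length of the list and its weight is the sum of the list.\<close>

definition is_partition :: "nat list \<Rightarrow> bool" where
  "is_partition la \<longleftrightarrow> sorted_wrt (\<ge>) la \<and> 0 \<notin> set la"

definition box_partitions :: "nat \<Rightarrow> nat \<Rightarrow> nat list set" where
  "box_partitions m k =
     {la. is_partition la \<and> length la \<le> m \<and> (la \<noteq> [] \<longrightarrow> hd la \<le> k)}"

section \<open>The polynomial rings $S = \mathbb{Q}[c_1, \dots, c_m]$ and $S[q]$\<close>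

text \<open>The type of rational polynomials in indeterminates indexed by the natural numbers: a monomial
  is a finitely supported exponent vector, and multiplication is convolution. The ring $S$ is the
  set of polynomials in which only the indeterminates with index in \<open>{1..m}\<close> occur.\<close>

type_synonym cpoly = "(nat \<Rightarrow>\<^sub>0 nat) \<Rightarrow>\<^sub>0 rat"

definition const_c :: "rat \<Rightarrow> cpoly" where
  "const_c a = Poly_Mapping.single 0 a"

definition S_carrier :: "nat \<Rightarrow> cpoly set" where
  "S_carrier m = {p. \<forall>t \<in> Poly_Mapping.keys p. Poly_Mapping.keys t \<subseteq> {1..m}}"

definition S_homogeneous :: "nat \<Rightarrow> cpoly \<Rightarrow> bool" where
  "S_homogeneous d p \<longleftrightarrow>
     (\<forall>t \<in> Poly_Mapping.keys p. (\<Sum>i \<in> Poly_Mapping.keys t. i * Poly_Mapping.lookup t i) = d)"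

definition c_gen :: "nat \<Rightarrow> int \<Rightarrow> cpoly" where
  "c_gen m i =
     (if i = 0 then 1
      else if 1 \<le> i \<and> i \<le> int m
        then Poly_Mapping.single (Poly_Mapping.single (nat i) 1) 1
      else 0)"

text \<open>The matrix indices below start at 0, which does not change the differences \<open>j - i\<close>.
  The determinant of the empty matrix is 1, which covers \<open>p = 0\<close> and the empty partition.\<close>

definition sigma :: "nat \<Rightarrow> int \<Rightarrow> cpoly" where
  "sigma m p =
     (if p < 0 then 0
      else Determinant.det (mat (nat p) (nat p) (\<lambda>(i, j). c_gen m (1 + int j - int i))))"

definition sigma_part :: "nat \<Rightarrow> nat list \<Rightarrow> cpoly" where
  "sigma_part m la =
     Determinant.det (mat (length la) (length la)
       (\<lambda>(i, j). sigma m (int (la ! i) + int j - int i)))"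

definition Sq :: "nat \<Rightarrow> cpoly poly ring" where
  "Sq m = \<lparr>carrier = {P. \<forall>i. Polynomial.coeff P i \<in> S_carrier m},
           monoid.mult = (*), one = 1, zero = 0, add = (+)\<rparr>"

text \<open>The coefficient of $q^i$ contributes degree $n i$, as $q$ has degree $n$. The zero polynomial
  is homogeneous of every degree.\<close>

definition Sq_homogeneous :: "nat \<Rightarrow> nat \<Rightarrow> cpoly poly \<Rightarrow> bool" where
  "Sq_homogeneous n d P \<longleftrightarrow>
     (\<forall>i. Polynomial.coeff P i \<noteq> 0 \<longrightarrow>
        n * i \<le> d \<and> S_homogeneous (d - n * i) (Polynomial.coeff P i))"

section \<open>The algebra $\mathrm{QH}_\alpha$\<close>

text \<open>Here \<open>k + 1 = n - m + 1\<close>; a polynomial \<open>[:s:]\<close> is the constant $s \in S$ in $S[q]$.\<close>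

definition QH_ideal :: "nat \<Rightarrow> nat \<Rightarrow> rat \<Rightarrow> cpoly poly set" where
  "QH_ideal m n \<alpha> =
     Idl\<^bsub>Sq m\<^esub>
       ({[:sigma m (int p):] | p. n - m + 1 \<le> p \<and> p \<le> n - 1}
        \<union> {[:sigma m (int n):] + Polynomial.monom ((-1) ^ m * const_c \<alpha>) 1})"

definition QH_class :: "nat \<Rightarrow> nat \<Rightarrow> rat \<Rightarrow> cpoly poly \<Rightarrow> cpoly poly set" where
  "QH_class m n \<alpha> P = QH_ideal m n \<alpha> +>\<^bsub>Sq m\<^esub> P"

text \<open>The quotient ring together with its scalar multiplication by \<open>rat poly\<close>, which plays the role
  of $\mathbb{Q}[q]$.\<close>

definition QH :: "nat \<Rightarrow> nat \<Rightarrow> rat \<Rightarrow> (rat poly, cpoly poly set) module" where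
  "QH m n \<alpha> =
     ring.extend (Sq m Quot QH_ideal m n \<alpha>)
       (module.fields
         (\<lambda>f x. QH_class m n \<alpha> (map_poly const_c f)
                  \<otimes>\<^bsub>Sq m Quot QH_ideal m n \<alpha>\<^esub> x))"

definition QH_q :: "nat \<Rightarrow> nat \<Rightarrow> rat \<Rightarrow> cpoly poly set" where
  "QH_q m n \<alpha> = QH_class m n \<alpha> (Polynomial.monom 1 1)"

definition QH_sigma :: "nat \<Rightarrow> nat \<Rightarrow> rat \<Rightarrow> nat list \<Rightarrow> cpoly poly set" where
  "QH_sigma m n \<alpha> la = QH_class m n \<alpha> [:sigma_part m la:]"

definition QH_homogeneous :: "nat \<Rightarrow> nat \<Rightarrow> rat \<Rightarrow> nat \<Rightarrow> cpoly poly set \<Rightarrow> bool" where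
  "QH_homogeneous m n \<alpha> d x \<longleftrightarrow>
     (\<exists>P \<in> carrier (Sq m). Sq_homogeneous n d P \<and> x = QH_class m n \<alpha> P)"

section \<open>Bases and structure constants\<close>

text \<open>A family indexed by a finite set is a basis of a module whose scalars are all elements of a
  type (here \<open>rat poly\<close>) if it generates the module and is linearly independent.\<close>

definition is_finite_basis ::
    "('r :: zero, 'a, 'b) module_scheme \<Rightarrow> 'i set \<Rightarrow> ('i \<Rightarrow> 'a) \<Rightarrow> bool" where
  "is_finite_basis M A v \<longleftrightarrow>
     finite A \<and> v \<in> A \<rightarrow> carrier M \<and>
     (\<forall>x \<in> carrier M. \<exists>f. x = (\<Oplus>\<^bsub>M\<^esub>i\<in>A. f i \<odot>\<^bsub>M\<^esub> v i)) \<and>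
     (\<forall>f. (\<Oplus>\<^bsub>M\<^esub>i\<in>A. f i \<odot>\<^bsub>M\<^esub> v i) = \<zero>\<^bsub>M\<^esub> \<longrightarrow> (\<forall>i \<in> A. f i = 0))"

text \<open>\<open>N la mu nu d\<close> is the coefficient of $q^d \tau_\nu$ in $\tau_\lambda \tau_\mu$; the scalar
  \<open>monom a d\<close> is $a q^d$.\<close>

definition is_structure_constants ::
    "(rat poly, 'a, 'b) module_scheme \<Rightarrow> 'i set \<Rightarrow> ('i \<Rightarrow> 'a) \<Rightarrow>
     ('i \<Rightarrow> 'i \<Rightarrow> 'i \<Rightarrow> nat \<Rightarrow> rat) \<Rightarrow> bool" where
  "is_structure_constants M A v N \<longleftrightarrow>
     (\<forall>la \<in> A. \<forall>mu \<in> A.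
        finite {(nu, d). nu \<in> A \<and> N la mu nu d \<noteq> 0} \<and>
        v la \<otimes>\<^bsub>M\<^esub> v mu =
          (\<Oplus>\<^bsub>M\<^esub>p \<in> {(nu, d). nu \<in> A \<and> N la mu nu d \<noteq> 0}.
             Polynomial.monom (N la mu (fst p) (snd p)) (snd p) \<odot>\<^bsub>M\<^esub> v (fst p)))"

end

theory Submission
  imports "Jordan_Normal_Form.Char_Poly" "HOL-Computational_Algebra.Formal_Power_Series" Defs
begin

text \<open>Condition (2) and the grading show that the transition matrix between $\tau$ and $\sigma$ is
  unipotent, with $\tau_\lambda = \sigma_\lambda$ whenever $|\lambda| < n$; in particular the special classes
  $\sigma_p$ with $p \le k$ belong to both bases. Suppose that $\tau \ne \sigma$, and let $d \ge 1$ be minimal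
  such that some $\sigma_\lambda = \tau_\lambda - \sum_\nu a_{\lambda\nu} q^d \tau_\nu + O(q^{d+1})$ has
  $a_\lambda \ne 0$. Let $h = \sigma_{p_1} \cdots \sigma_{p_m}$ and $h' = \sigma_{r_1} \cdots \sigma_{r_m}$ be products
  of $m$ special classes. Then:

  \<^item> by the Pieri rule, $h$ is a non-negative combination of the $\sigma_\lambda$, without any $q$;

  \<^item> the coefficient of the point class in $h' \sigma_\lambda$ is a non-negative constant
    $\int h' \sigma_\lambda$, again without any $q$. Since $h' \tau_\lambda$ is non-negative, comparing the coefficients
    of $q^d$ gives $\sum_\nu a_{\lambda\nu} \int h' \sigma_\nu \ge 0$;

  \<^item> $h$ itself is non-negative in the basis $\tau$. Let $u_\nu \ge 0$ be its coefficient of $q^d \tau_\nu$. By the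
    previous two points, $\sum_\nu u_\nu \int h' \sigma_\nu \le 0$.

  For each $\nu$ some $h'$ has $\int h' \sigma_\nu > 0$, so $u = 0$ for every $h$. But the determinants $\sigma_\lambda$
  are signed sums of such products $h$, so $a = 0$, a contradiction.\<close>

section \<open>Pieri rule for Jacobi-Trudi determinants\<close>

text \<open>As \<alpha> may be negative, terms with q can enter products of the \<sigma> classes
  with either sign, so no positivity of such products is available. Only computations in which q
  drops out can be used, and the number m of factors is what makes q drop out. When a product of at
  most m special classes is built up from 1, each factor multiplies a determinant with at most m - 1
  rows; the entries of this determinant and of the resulting ones inside the box have index below n,
  so \<sigma>_n does not occur. In the point coefficient of h' \<sigma>_\<lambda>, a partition that
  leaves the box is straightened, at the cost of a factor q, to one whose first row is shorter than
  k. Each later factor moves such a deficit down by at most one row, and the at most m - 1 remaining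
  factors cannot push it out of the box. Conversely m factors suffice: m strips fill the m rows of a
  partition one by one, and an m by m determinant is a signed sum of products of m entries.\<close>

definition jt_det :: "(int \<Rightarrow> 'a :: comm_ring_1) \<Rightarrow> nat \<Rightarrow> (nat \<Rightarrow> int) \<Rightarrow> 'a" where
  "jt_det H N a = det (mat N N (\<lambda>(i, j). H (a i + int j - int i)))"

lemma jt_det_cong:
  assumes "\<And>i j. i < N \<Longrightarrow> j < N \<Longrightarrow> H (a i + int j - int i) = H' (b i + int j - int i)"
  shows "jt_det H N a = jt_det H' N b"
  unfolding jt_det_def by (rule arg_cong[where f = det], rule eq_matI) (auto simp: assms)

lemma jt_det_expand:
  "jt_det H N a = (\<Sum>\<pi> | \<pi> permutes {0..<N}. of_int (sign \<pi>) *
     (\<Prod>i = 0..<N. H (a i + int (\<pi> i) - int i)))"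
proof -
  have "(\<Prod>i = 0..<N. mat N N (\<lambda>(i, j). H (a i + int j - int i)) $$ (i, \<pi> i)) =
        (\<Prod>i = 0..<N. H (a i + int (\<pi> i) - int i))" if "\<pi> permutes {0..<N}" for \<pi>
    by (rule prod.cong[OF refl]) (use permutes_in_image[OF that] in auto)
  then show ?thesis
    unfolding jt_det_def by (subst det_def'[of _ N]) (auto intro!: sum.cong)
qed

section \<open>Determinants of unitriangular matrices and removal of a last row\<close>

lemma prod_list_diag_unit:
  assumes "A \<in> carrier_mat n n" and "\<And>i. i < n \<Longrightarrow> A $$ (i, i) = (1 :: 'a :: comm_ring_1)"
  shows "prod_list (diag_mat A) = 1"
proof -
  have "diag_mat A = map (\<lambda>i. 1) [0..<n]"
    using assms by (auto simp: diag_mat_def)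
  then show ?thesis
    by (simp add: map_replicate_const)
qed

lemma det_unitriangular_lower:
  assumes "A \<in> carrier_mat n n" and "\<And>i. i < n \<Longrightarrow> A $$ (i, i) = (1 :: 'a :: comm_ring_1)"
    and "\<And>i j. i < j \<Longrightarrow> j < n \<Longrightarrow> A $$ (i, j) = 0"
  shows "det A = 1"
  using det_lower_triangular[OF assms(3,1)] prod_list_diag_unit[OF assms(1,2)] by simp

lemma det_unitriangular_upper:
  assumes "A \<in> carrier_mat n n" and "\<And>i. i < n \<Longrightarrow> A $$ (i, i) = (1 :: 'a :: comm_ring_1)"
    and "\<And>i j. j < i \<Longrightarrow> i < n \<Longrightarrow> A $$ (i, j) = 0"
  shows "det A = 1"
  using det_upper_triangular[OF _ assms(1)] prod_list_diag_unit[OF assms(1,2)] assms(1,3)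
  by (auto simp: upper_triangular_def)

lemma det_last_row_unit:
  assumes A: "A \<in> carrier_mat (Suc n) (Suc n)"
    and zero: "\<And>j. j < n \<Longrightarrow> A $$ (n, j) = 0"
  shows "det A = A $$ (n, n) * det (mat n n (\<lambda>(i, j). A $$ (i, j)))"
proof -
  have "det A = (\<Sum>j<Suc n. A $$ (n, j) * cofactor A n j)"
    by (rule laplace_expansion_row[OF A]) simp
  also have "\<dots> = A $$ (n, n) * cofactor A n n"
    by (simp add: zero)
  also have "mat_delete A n n = mat n n (\<lambda>(i, j). A $$ (i, j))"
    using A by (intro eq_matI) (auto simp: mat_delete_def)
  then have "cofactor A n n = det (mat n n (\<lambda>(i, j). A $$ (i, j)))"
    by (simp add: cofactor_def mult_2[symmetric] flip: power_mult_distrib)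
  finally show ?thesis .
qed

lemma jt_det_last_row_zero:
  assumes "H 0 = 1" and "\<And>x. x < 0 \<Longrightarrow> H x = 0" and "a N = 0"
  shows "jt_det H (Suc N) a = jt_det H N a"
  unfolding jt_det_def
  by (subst det_last_row_unit)
     (auto simp: assms intro!: arg_cong[where f = det] eq_matI)

section \<open>Generating series for the Pieri rule\<close>

definition tail_fps :: "(int \<Rightarrow> 'a :: comm_ring_1) \<Rightarrow> int \<Rightarrow> 'a fps" where
  "tail_fps H x = Abs_fps (\<lambda>b. H (x + int b))"

lemma tail_fps_split:
  "tail_fps H x = (\<Sum>b<l. fps_X ^ b * fps_const (H (x + int b))) + fps_X ^ l * tail_fps H (x + int l)"
proof (induction l)
  case (Suc l)
  have "tail_fps H y = fps_const (H y) + fps_X * tail_fps H (y + 1)" for y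
    by (rule fps_ext) (simp add: tail_fps_def of_nat_diff)
  from this[of "x + int l"] show ?case
    by (subst Suc) (simp add: algebra_simps)
qed simp

lemma tail_fps_finite:
  assumes "\<And>y. y > M \<Longrightarrow> H y = 0" and "x + int l > M"
  shows "tail_fps H x = (\<Sum>b<l. fps_X ^ b * fps_const (H (x + int b)))"
proof -
  have "tail_fps H (x + int l) = 0"
    using assms by (intro fps_ext) (simp add: tail_fps_def)
  then show ?thesis
    by (subst tail_fps_split[of _ _ l]) simp
qed

text \<open>Subtracting \<open>fps_X\<close> times column \<open>j + 1\<close> from column
  \<open>j\<close> leaves a single constant in every entry outside the last column. As
  \<open>a N = 0\<close>, the last row then keeps only its corner \<open>tail_fps H 0\<close>. The
  outcome is the generating series in \<open>p\<close> of the left-hand side of the Pieri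
  rule.\<close>

lemma det_tail_fps_matrix:
  assumes Hneg: "\<And>x. x < 0 \<Longrightarrow> H x = (0 :: 'a :: comm_ring_1)" and aN: "a N = 0"
  shows "det (mat (Suc N) (Suc N) (\<lambda>(i, j). tail_fps H (a i + int j - int i))) =
           tail_fps H 0 * fps_const (jt_det H N a)"
    (is "det ?G = _")
proof -
  define U where "U = mat (Suc N) (Suc N)
    (\<lambda>(i, j). if i = j then 1 else if i = Suc j then - fps_X else (0 :: 'a fps))"
  have G: "?G \<in> carrier_mat (Suc N) (Suc N)" and U: "U \<in> carrier_mat (Suc N) (Suc N)"
    by (auto simp: U_def)
  have GU: "(?G * U) $$ (i, j) = (if j < N then fps_const (H (a i + int j - int i))
      else tail_fps H (a i + int j - int i))" if "i \<le> N" "j \<le> N" for i j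
  proof -
    have "(?G * U) $$ (i, j) = (\<Sum>l\<in>{0..<Suc N}. tail_fps H (a i + int l - int i) *
        ((if l = j then 1 else 0) + (if l = Suc j then - fps_X else 0)))"
      using that by (auto simp: scalar_prod_def U_def intro!: sum.cong)
    also have "\<dots> = tail_fps H (a i + int j - int i) -
        (if j < N then fps_X * tail_fps H (a i + int j - int i + 1) else 0)"
      using that by (auto simp: distrib_left sum.distrib if_distrib[where f = "\<lambda>c. c * _"] ac_simps add_diff_eq
          simp del: sum.op_ivl_Suc cong: if_cong)
    finally show ?thesis
      using tail_fps_split[of H "a i + int j - int i" 1] by (auto split: if_splits)
  qed
  have "det ?G = det (?G * U)"
    using det_unitriangular_lower[OF U] det_mult[OF G U] by (simp add: U_def)
  also have "\<dots> = (?G * U) $$ (N, N) * det (mat N N (\<lambda>(i, j). (?G * U) $$ (i, j)))"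
    by (rule det_last_row_unit[OF mult_carrier_mat[OF G U]]) (auto simp: GU aN Hneg simp del: index_mult_mat)
  also have "mat N N (\<lambda>(i, j). (?G * U) $$ (i, j)) =
      map_mat fps_const (mat N N (\<lambda>(i, j). H (a i + int j - int i)))"
    by (rule eq_matI) (auto simp: GU simp del: index_mult_mat)
  also have "det \<dots> = fps_const (jt_det H N a)"
  proof -
    interpret comm_ring_hom "fps_const :: 'a \<Rightarrow> 'a fps"
      by unfold_locales auto
    show ?thesis
      by (simp add: jt_det_def)
  qed
  finally show ?thesis
    by (simp add: GU aN del: index_mult_mat)
qed

text \<open>Subtracting $t^l$ times row \<open>i - 1\<close> from row \<open>i\<close> cuts the power series off exactly where
  \<open>b i\<close> would exceed \<open>a (i - 1)\<close>, so no cancelling involution is needed for the Pieri rule.\<close>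

lemma det_tail_fps_matrix_strips:
  assumes anti: "\<And>i. i < N \<Longrightarrow> a (Suc i) \<le> (a i :: nat)"
    and M: "\<And>y. y > M \<Longrightarrow> H y = (0 :: 'a :: comm_ring_1)" and L: "int L > M + int N"
  shows "det (mat (Suc N) (Suc N) (\<lambda>(i, j). tail_fps H (int (a i) + int j - int i))) =
    det (mat (Suc N) (Suc N) (\<lambda>(i, j). \<Sum>b < (if i = 0 then L else Suc (a (i - 1) - a i)).
      fps_X ^ b * fps_const (H (int (a i) + int j - int i + int b))))"
    (is "det ?G = det ?F")
proof -
  let ?l = "\<lambda>i. Suc (a (i - 1) - a i)"
  define U where "U = mat (Suc N) (Suc N)
    (\<lambda>(i, j). if i = j then 1 else if i = Suc j then - (fps_X ^ ?l i) else (0 :: 'a fps))"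
  have G: "?G \<in> carrier_mat (Suc N) (Suc N)" and U: "U \<in> carrier_mat (Suc N) (Suc N)"
    by (auto simp: U_def)
  have UG: "(U * ?G) $$ (i, j) = ?F $$ (i, j)" if "i \<le> N" "j \<le> N" for i j
  proof -
    have "(U * ?G) $$ (i, j) = (\<Sum>l\<in>{0..<Suc N}.
        ((if l = i then 1 else 0) + (if i \<noteq> 0 \<and> l = i - 1 then - (fps_X ^ ?l i) else 0)) *
        tail_fps H (int (a l) + int j - int l))"
      using that by (auto simp: scalar_prod_def U_def intro!: sum.cong)
    also have "\<dots> = tail_fps H (int (a i) + int j - int i) - (if i = 0 then 0 else
        fps_X ^ ?l i * tail_fps H (int (a (i - 1)) + int j - int (i - 1)))"
      using that by (cases i) (auto simp add: distrib_right sum.distrib if_distrib[where f = "\<lambda>c. c * _"]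
          cong: if_cong)
    also have "\<dots> = ?F $$ (i, j)"
    proof (cases "i = 0")
      case True
      then show ?thesis
        using that tail_fps_finite[of M H "int (a i) + int j - int i" L] M L by auto
    next
      case False
      then have y: "int (a (i - 1)) + int j - int (i - 1) = int (a i) + int j - int i + int (?l i)"
        using anti[of "i - 1"] that by auto
      show ?thesis
        unfolding y by (subst tail_fps_split[of _ _ "?l i"]) (use False that in simp)
    qed
    finally show ?thesis .
  qed
  have "det ?G = det (U * ?G)"
    using det_unitriangular_lower[OF U] det_mult[OF U G] by (simp add: U_def)
  also have "U * ?G = ?F"
    by (rule eq_matI) (use UG U in \<open>auto simp del: index_mult_mat(1)\<close>)
  finally show ?thesis .
qed

text \<open>The interlacing form of the condition that \<open>b/a\<close> is a horizontal strip of
  \<open>p\<close> boxes in at most \<open>N + 1\<close> rows; interlacing already forces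
  \<open>b\<close> to decrease.\<close>

definition hstrips :: "nat \<Rightarrow> (nat \<Rightarrow> nat) \<Rightarrow> nat \<Rightarrow> (nat \<Rightarrow> nat) set" where
  "hstrips N a p = {b. (\<forall>i>N. b i = 0) \<and> a 0 \<le> b 0 \<and>
     (\<forall>i<N. a (Suc i) \<le> b (Suc i) \<and> b (Suc i) \<le> a i) \<and> (\<Sum>i\<le>N. b i) = (\<Sum>i\<le>N. a i) + p}"

text \<open>Multilinearity in the rows: the cut-off \<open>l i\<close> depends on the row alone, so
  one exponent \<open>g i\<close> can be chosen per row, and the resulting power of
  \<open>fps_X\<close> is common to all permutations.\<close>

lemma det_sum_monomials_coeff:
  fixes h :: "nat \<Rightarrow> nat \<Rightarrow> nat \<Rightarrow> 'a :: comm_ring_1"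
  shows "fps_nth (det (mat n n (\<lambda>(i, j). \<Sum>b<l i. fps_X ^ b * fps_const (h i j b)))) p =
    (\<Sum>g | g \<in> PiE {0..<n} (\<lambda>i. {..<l i}) \<and> sum g {0..<n} = p. det (mat n n (\<lambda>(i, j). h i j (g i))))"
    (is "fps_nth (det ?F) p = _")
proof -
  let ?S = "{\<pi>. \<pi> permutes {0..<n}}"
  let ?G = "PiE {0..<n} (\<lambda>i. {..<l i})"
  have fin: "finite ?G"
    by (intro finite_PiE) auto
  have prod_mat: "(\<Prod>i = 0..<n. mat n n f $$ (i, \<pi> i)) = (\<Prod>i = 0..<n. f (i, \<pi> i))"
    if "\<pi> permutes {0..<n}" for \<pi> and f :: "nat \<times> nat \<Rightarrow> 'b :: comm_ring_1"
    by (rule prod.cong[OF refl]) (use permutes_in_image[OF that] in auto)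
  have X: "(\<Prod>i\<in>A. fps_X ^ g i * fps_const (f i)) = fps_X ^ sum g A * fps_const (\<Prod>i\<in>A. f i)"
    for g A and f :: "nat \<Rightarrow> 'a"
  proof -
    have "(\<Prod>i\<in>A. fps_const (f i)) = fps_const (\<Prod>i\<in>A. f i)"
      by (induction A rule: infinite_finite_induct) auto
    then show ?thesis
      by (simp add: prod.distrib power_sum)
  qed
  have C: "fps_const (sum f A) = (\<Sum>i\<in>A. fps_const (f i))" for A and f :: "(nat \<Rightarrow> nat) \<Rightarrow> 'a"
    by (induction A rule: infinite_finite_induct) (auto simp flip: fps_const_add)
  have "det ?F = (\<Sum>\<pi>\<in>?S. of_int (sign \<pi>) *
      (\<Prod>i = 0..<n. \<Sum>b<l i. fps_X ^ b * fps_const (h i (\<pi> i) b)))"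
    by (subst det_def'[of _ n]) (auto intro!: sum.cong simp: prod_mat)
  also have "\<dots> = (\<Sum>\<pi>\<in>?S. \<Sum>g\<in>?G. of_int (sign \<pi>) *
      (fps_X ^ sum g {0..<n} * fps_const (\<Prod>i = 0..<n. h i (\<pi> i) (g i))))"
    by (subst prod_sum_PiE) (auto simp: X sum_distrib_left)
  also have "\<dots> = (\<Sum>g\<in>?G. \<Sum>\<pi>\<in>?S. of_int (sign \<pi>) *
      (fps_X ^ sum g {0..<n} * fps_const (\<Prod>i = 0..<n. h i (\<pi> i) (g i))))"
    by (rule sum.swap)
  also have "\<dots> = (\<Sum>g\<in>?G. fps_X ^ sum g {0..<n} *
      fps_const (\<Sum>\<pi>\<in>?S. of_int (sign \<pi>) * (\<Prod>i = 0..<n. h i (\<pi> i) (g i))))"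
    by (intro sum.cong refl) (simp add: C sum_distrib_left mult.left_commute
        fps_of_int[symmetric] fps_const_mult[symmetric] del: fps_of_int fps_const_mult)
  also have "\<dots> = (\<Sum>g\<in>?G. fps_X ^ sum g {0..<n} * fps_const (det (mat n n (\<lambda>(i, j). h i j (g i)))))"
    by (intro sum.cong refl, subst det_def'[of _ n])
       (auto simp: prod_mat intro!: arg_cong2[where f = "(*)"] arg_cong[where f = fps_const] sum.cong)
  finally have "fps_nth (det ?F) p = (\<Sum>g\<in>?G. if sum g {0..<n} = p then det (mat n n (\<lambda>(i, j). h i j (g i))) else 0)"
    by (auto simp: fps_sum_nth fps_X_power_mult_nth intro!: sum.cong)
  then show ?thesis
    by (simp add: sum.inter_filter[OF fin, symmetric])
qed

text \<open>Row 0 has no row above it that could cut off its series; the vanishing of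
  \<open>H\<close> above \<open>M\<close> makes this row finite as well.\<close>

lemma pieri_finite:
  assumes Hneg: "\<And>x. x < 0 \<Longrightarrow> H x = (0 :: 'a :: comm_ring_1)"
    and M: "\<And>y. y > M \<Longrightarrow> H y = 0"
    and anti: "\<And>i. i < N \<Longrightarrow> a (Suc i) \<le> (a i :: nat)" and aN: "a N = 0"
  shows "H (int p) * jt_det H N (\<lambda>i. int (a i)) = (\<Sum>b\<in>hstrips N a p. jt_det H (Suc N) (\<lambda>i. int (b i)))"
proof -
  \<comment> \<open>\<open>L\<close> serves two purposes: the series in row 0 end before it, and
    \<open>L > p\<close> excludes no strip, since row 0 receives at most \<open>p\<close>
    boxes.\<close>
  define L where "L = Suc p + nat (\<bar>M\<bar> + int N + 1)"
  define l where "l i = (if i = 0 then L else Suc (a (i - 1) - a i))" for i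
  have "H (int p) * jt_det H N (\<lambda>i. int (a i)) =
      fps_nth (tail_fps H 0 * fps_const (jt_det H N (\<lambda>i. int (a i)))) p"
    by (simp add: tail_fps_def)
  also have "tail_fps H 0 * fps_const (jt_det H N (\<lambda>i. int (a i))) =
      det (mat (Suc N) (Suc N) (\<lambda>(i, j). tail_fps H (int (a i) + int j - int i)))"
    using Hneg aN by (intro det_tail_fps_matrix[symmetric]) auto
  also have "\<dots> = det (mat (Suc N) (Suc N) (\<lambda>(i, j). \<Sum>b < l i.
      fps_X ^ b * fps_const (H (int (a i) + int j - int i + int b))))"
    unfolding l_def by (rule det_tail_fps_matrix_strips[where M = M]) (auto simp: L_def anti M)
  also have "fps_nth \<dots> p = (\<Sum>g | g \<in> PiE {0..<Suc N} (\<lambda>i. {..<l i}) \<and> sum g {0..<Suc N} = p.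
      det (mat (Suc N) (Suc N) (\<lambda>(i, j). H (int (a i) + int j - int i + int (g i)))))"
    by (rule det_sum_monomials_coeff)
  also have "\<dots> = (\<Sum>b\<in>hstrips N a p. jt_det H (Suc N) (\<lambda>i. int (b i)))"
  \<comment> \<open>The exponent \<open>g i\<close> is the number of boxes added to row
    \<open>i\<close>; for \<open>i > 0\<close> the bound \<open>g i < l i\<close> says that
    \<open>b i \<le> a (i - 1)\<close>.\<close>
  proof (rule sum.reindex_bij_witness[where j = "\<lambda>g i. if i \<le> N then a i + g i else 0"
        and i = "\<lambda>b. restrict (\<lambda>i. b i - a i) {0..<Suc N}"], goal_cases)
    case (1 g)
    then show ?case
      by (auto simp: fun_eq_iff PiE_def extensional_def)
  next
    case (2 g)
    have "a (Suc i) + g (Suc i) \<le> a i" if "i < N" for i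
    proof -
      have "g (Suc i) \<in> {..<l (Suc i)}"
        using 2 that by (intro PiE_mem[of g "{0..<Suc N}"]) auto
      with anti[OF that] show ?thesis
        by (simp add: l_def)
    qed
    with 2 show ?case
      by (auto simp: hstrips_def sum.distrib atLeast0LessThan lessThan_Suc_atMost simp del: sum.lessThan_Suc sum.atMost_Suc)
  next
    case (3 b)
    have "a i \<le> b i" if "i \<le> N" for i
      using 3 that by (cases i) (auto simp: hstrips_def)
    then show ?case
      using 3 by (auto simp: hstrips_def fun_eq_iff)
  next
    case (4 b)
    have ab: "a i \<le> b i" if "i \<le> N" for i
      using 4 that by (cases i) (auto simp: hstrips_def)
    have "(\<Sum>i\<le>N. b i - a i) = (\<Sum>i\<le>N. b i) - (\<Sum>i\<le>N. a i)"
      using ab by (intro sum_subtractf_nat) auto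
    then have s: "(\<Sum>i\<le>N. b i - a i) = p"
      using 4 by (simp add: hstrips_def)
    have "b i - a i < l i" if "i \<le> N" for i
    proof (cases i)
      case 0
      have "b 0 - a 0 \<le> (\<Sum>i\<le>N. b i - a i)"
        by (rule member_le_sum[of 0 "{..N}" "\<lambda>i. b i - a i"]) auto
      then show ?thesis
        using s 0 by (simp add: l_def L_def)
    next
      case (Suc j)
      then show ?thesis
        using 4 that by (auto simp: l_def hstrips_def less_Suc_eq_le intro!: diff_le_mono)
    qed
    with s show ?case
      by (auto simp: atLeast0LessThan lessThan_Suc_atMost simp del: sum.lessThan_Suc sum.atMost_Suc)
  next
    case (5 g)
    then show ?case
      unfolding jt_det_def
      by (intro arg_cong[where f = det] eq_matI) (auto simp: algebra_simps)
  qed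
  finally show ?thesis .
qed

text \<open>Both sides involve only finitely many values of \<open>H\<close>, so \<open>H\<close>
  may be cut off above a bound for their indices.\<close>

lemma pieri:
  assumes Hneg: "\<And>x. x < 0 \<Longrightarrow> H x = (0 :: 'a :: comm_ring_1)"
    and anti: "\<And>i. i < N \<Longrightarrow> a (Suc i) \<le> (a i :: nat)" and aN: "a N = 0"
  shows "H (int p) * jt_det H N (\<lambda>i. int (a i)) = (\<Sum>b\<in>hstrips N a p. jt_det H (Suc N) (\<lambda>i. int (b i)))"
proof -
  define M where "M = int (\<Sum>i\<le>N. a i) + int p + int N"
  define H' where "H' x = (if x > M then 0 else H x)" for x
  have le: "b i \<le> (\<Sum>i\<le>N. b i)" if "i \<le> N" for b :: "nat \<Rightarrow> nat" and i
    using that by (intro member_le_sum) auto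
  have M0: "0 \<le> M" "int p \<le> M"
    unfolding M_def by linarith+
  have "H (int p) * jt_det H N (\<lambda>i. int (a i)) = H' (int p) * jt_det H' N (\<lambda>i. int (a i))"
  proof (rule arg_cong2[where f = "(*)"])
    show "H (int p) = H' (int p)"
      using M0 by (simp add: H'_def)
    show "jt_det H N (\<lambda>i. int (a i)) = jt_det H' N (\<lambda>i. int (a i))"
    proof (rule jt_det_cong)
      fix i j assume "i < N" "j < N"
      then have "int (a i) + int j - int i \<le> M"
        unfolding M_def using le[of i a] by linarith
      then show "H (int (a i) + int j - int i) = H' (int (a i) + int j - int i)"
        by (simp add: H'_def)
    qed
  qed
  also have "\<dots> = (\<Sum>b\<in>hstrips N a p. jt_det H' (Suc N) (\<lambda>i. int (b i)))"
    by (rule pieri_finite[where M = M, OF _ _ anti aN]) (use M0 in \<open>auto simp: H'_def Hneg\<close>)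
  also have "\<dots> = (\<Sum>b\<in>hstrips N a p. jt_det H (Suc N) (\<lambda>i. int (b i)))"
  proof (intro sum.cong refl jt_det_cong)
    fix b i j assume b: "b \<in> hstrips N a p" and "i < Suc N" "j < Suc N"
    moreover have "(\<Sum>i\<le>N. b i) = (\<Sum>i\<le>N. a i) + p"
      using b by (simp add: hstrips_def)
    ultimately have "int (b i) + int j - int i \<le> M"
      unfolding M_def using le[of i b] by linarith
    then show "H' (int (b i) + int j - int i) = H (int (b i) + int j - int i)"
      by (simp add: H'_def)
  qed
  finally show ?thesis .
qed

lemma finite_hstrips: "finite (hstrips N a p)"
proof (rule finite_subset)
  have "b i \<le> (\<Sum>i\<le>N. b i)" if "i \<le> N" for b :: "nat \<Rightarrow> nat" and i
    using that by (intro member_le_sum) auto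
  then show "hstrips N a p \<subseteq> {b. \<forall>i. (i \<in> {..N} \<longrightarrow> b i \<in> {..(\<Sum>i\<le>N. a i) + p}) \<and> (i \<notin> {..N} \<longrightarrow> b i = 0)}"
    by (auto simp: hstrips_def not_le simp del: sum.atMost_Suc) (metis)
qed (rule finite_set_of_finite_funs; simp)

section \<open>Complete symmetric functions in finitely many variables\<close>

text \<open>The Wronski relation between elementary and complete symmetric functions; that its sum
  stops at \<open>i = m\<close> expresses that there are \<open>m\<close> variables.\<close>

locale complete_sequence =
  fixes m :: nat and e :: "nat \<Rightarrow> 'r :: comm_ring_1" and \<sigma> :: "int \<Rightarrow> 'r"
  assumes e_0: "e 0 = 1"
    and \<sigma>_0: "\<sigma> 0 = 1"
    and \<sigma>_neg: "x < 0 \<Longrightarrow> \<sigma> x = 0"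
    and \<sigma>_rec: "x \<ge> 1 \<Longrightarrow> (\<Sum>i\<le>m. (-1) ^ i * e i * \<sigma> (x - int i)) = 0"
begin

text \<open>The recursion is a linear relation among the \<open>m + 1\<close> columns, with
  coefficient 1 at the last one. It applies in every row because \<open>b i \<ge> 1\<close> makes
  the index \<open>b i + m - i\<close> positive.\<close>

lemma jt_det_eq_0:
  assumes "\<And>i. i \<le> m \<Longrightarrow> b i \<ge> (1 :: nat)"
  shows "jt_det \<sigma> (Suc m) (\<lambda>i. int (b i)) = 0"
proof -
  define A where "A = mat (Suc m) (Suc m) (\<lambda>(i, j). \<sigma> (int (b i) + int j - int i))"
  define U where "U = mat (Suc m) (Suc m)
    (\<lambda>(i, j). if j = m then (-1) ^ (m - i) * e (m - i) else if i = j then 1 else 0)"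
  have A: "A \<in> carrier_mat (Suc m) (Suc m)" and U: "U \<in> carrier_mat (Suc m) (Suc m)"
    by (auto simp: A_def U_def)
  have last_col: "(A * U) $$ (i, m) = 0" if "i \<le> m" for i
  proof -
    have "(A * U) $$ (i, m) =
        (\<Sum>j\<le>m. \<sigma> (int (b i) + int j - int i) * ((-1) ^ (m - j) * e (m - j)))"
      using that by (auto simp: A_def U_def scalar_prod_def atLeast0LessThan lessThan_Suc_atMost
          simp del: sum.lessThan_Suc sum.atMost_Suc intro!: sum.cong)
    also have "\<dots> = (\<Sum>j\<le>m. (-1) ^ j * e j * \<sigma> (int (b i) + int m - int i - int j))"
      by (rule sum.reindex_bij_witness[where i = "\<lambda>j. m - j" and j = "\<lambda>j. m - j"])
         (auto simp: of_nat_diff algebra_simps)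
    also have "\<dots> = 0"
      using that assms[OF that] by (intro \<sigma>_rec) linarith
    finally show ?thesis .
  qed
  have "det A = det (A * U)"
    using det_unitriangular_upper[OF U] det_mult[OF A U] by (simp add: U_def e_0)
  also have "\<dots> = (\<Sum>i<Suc m. (A * U) $$ (i, m) * cofactor (A * U) i m)"
    by (rule laplace_expansion_column[OF mult_carrier_mat[OF A U]]) simp
  also have "\<dots> = 0"
    using last_col by (intro sum.neutral) auto
  finally show ?thesis
    by (simp add: A_def jt_det_def)
qed

text \<open>A strip that reaches row \<open>m\<close> has no zero row, since
  \<open>b m \<le> a (m - 1) \<le> a i \<le> b i\<close> for \<open>i < m\<close>, and its
  determinant vanishes. The other determinants lose their last row.\<close>

lemma pieri_bounded_length:
  assumes m: "m \<ge> 1" and anti: "\<And>i. a (Suc i) \<le> (a i :: nat)" and am: "a m = 0"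
  shows "\<sigma> (int p) * jt_det \<sigma> m (\<lambda>i. int (a i)) =
    (\<Sum>b\<in>hstrips (m - 1) a p. jt_det \<sigma> m (\<lambda>i. int (b i)))"
proof -
  have mono: "a j \<le> a i" if "i \<le> j" for i j
    using that by (rule lift_Suc_antimono_le[where f = a, OF anti])
  have split: "(\<forall>i<m. Q i) \<longleftrightarrow> (\<forall>i<m - 1. Q i) \<and> Q (m - 1)" for Q
    using m by (cases m) (auto simp: less_Suc_eq)
  have fin: "finite (hstrips m a p)"
    by (rule finite_hstrips)
  have sub: "hstrips (m - 1) a p = {b \<in> hstrips m a p. b m = 0}"
  proof -
    have "(\<Sum>i\<le>m. f i) = (\<Sum>i\<le>m - 1. f i) + f m" for f :: "nat \<Rightarrow> nat"
      using m by (cases m) auto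
    moreover have "(\<forall>i>m - 1. b i = 0) \<longleftrightarrow> (\<forall>i>m. b i = 0) \<and> b m = 0" for b :: "nat \<Rightarrow> nat"
    proof -
      have "i > m - 1 \<longleftrightarrow> i > m \<or> i = m" for i
        using m by auto
      then show ?thesis
        by auto
    qed
    ultimately show ?thesis
      using m am by (auto simp: hstrips_def split)
  qed
  have "\<sigma> (int p) * jt_det \<sigma> m (\<lambda>i. int (a i)) = (\<Sum>b\<in>hstrips m a p. jt_det \<sigma> (Suc m) (\<lambda>i. int (b i)))"
    by (rule pieri[where H = \<sigma> and N = m and a = a, OF \<sigma>_neg anti am])
  also have "\<dots> = (\<Sum>b\<in>hstrips (m - 1) a p. jt_det \<sigma> (Suc m) (\<lambda>i. int (b i)))"
  proof (rule sum.mono_neutral_right[OF fin])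
    show "\<forall>b\<in>hstrips m a p - hstrips (m - 1) a p. jt_det \<sigma> (Suc m) (\<lambda>i. int (b i)) = 0"
    proof (intro ballI jt_det_eq_0)
      fix b i assume b: "b \<in> hstrips m a p - hstrips (m - 1) a p" and i: "i \<le> m"
      then have b': "b \<in> hstrips m a p" "b m \<noteq> 0"
        unfolding sub by auto
      then have bm: "b m \<ge> 1" "b m \<le> a (m - 1)"
        using m by (auto simp: hstrips_def split)
      show "b i \<ge> 1"
      proof (cases "i = m")
        case False
        have "a i \<le> b i"
          using b' i False by (cases i) (auto simp: hstrips_def)
        with bm mono[of i "m - 1"] False i show ?thesis
          by linarith
      qed (use bm in simp)
    qed
  qed (use sub in blast)
  also have "\<dots> = (\<Sum>b\<in>hstrips (m - 1) a p. jt_det \<sigma> m (\<lambda>i. int (b i)))"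
    by (intro sum.cong refl jt_det_last_row_zero) (use sub in \<open>auto simp: \<sigma>_0 \<sigma>_neg\<close>)
  finally show ?thesis .
qed

text \<open>Row \<open>i\<close> depends only on \<open>g i = f i - int i\<close>. Equal values give
  equal rows and a value at most \<open>- m\<close> gives a zero row; otherwise sorting the rows
  turns \<open>f\<close> into a partition, whose first part is the largest \<open>g i\<close> and
  hence less than \<open>k\<close>.\<close>

lemma jt_det_straighten:
  assumes le: "\<And>i. i < m \<Longrightarrow> f i - int i \<le> int k - 1"
  shows "jt_det \<sigma> m f = 0 \<or> (\<exists>\<rho>. (\<forall>i. \<rho> (Suc i) \<le> \<rho> i) \<and> (\<forall>i\<ge>m. \<rho> i = 0) \<and> (m \<ge> 1 \<longrightarrow> \<rho> 0 < k) \<and>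
    (jt_det \<sigma> m f = jt_det \<sigma> m (\<lambda>i. int (\<rho> i)) \<or> jt_det \<sigma> m f = - jt_det \<sigma> m (\<lambda>i. int (\<rho> i))))"
proof -
  define g where "g i = f i - int i" for i
  define A where "A = mat m m (\<lambda>(i, j). \<sigma> (g i + int j))"
  have A: "A \<in> carrier_mat m m"
    by (simp add: A_def)
  have D: "jt_det \<sigma> m f = det A"
    unfolding A_def jt_det_def by (intro arg_cong[where f = det] eq_matI) (auto simp: g_def algebra_simps)
  show ?thesis
  proof (cases "inj_on g {..<m} \<and> (\<forall>i<m. g i > - int m)")
    case False
    then consider i where "i < m" "g i \<le> - int m" | i j where "i < m" "j < m" "i \<noteq> j" "g i = g j"
      by (force simp: inj_on_def not_less)
    then have "det A = 0"
    proof cases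
      case 1
      have "det A = (\<Sum>j<m. A $$ (i, j) * cofactor A i j)"
        by (rule laplace_expansion_row[OF A 1(1)])
      also have "\<dots> = 0"
        using 1 by (intro sum.neutral) (auto simp: A_def \<sigma>_neg)
      finally show ?thesis .
    next
      case 2
      then show ?thesis
        by (intro det_identical_rows[OF A, of i j]) (auto simp: A_def row_def)
    qed
    then show ?thesis
      by (simp add: D)
  next
    case True
    define xs where "xs = rev (sorted_list_of_set (g ` {..<m}))"
    have len: "length xs = m"
      using True by (simp add: xs_def card_image)
    have set: "set xs = g ` {..<m}"
      by (simp add: xs_def)
    have dist: "distinct xs"
      by (simp add: xs_def)
    have desc: "xs ! i > xs ! j" if "i < j" "j < m" for i j
    proof -
      have "sorted_wrt (\<lambda>x y. x > y) xs"
        by (simp add: xs_def sorted_wrt_rev)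
      then show ?thesis
        using sorted_wrt_nth_less[of "\<lambda>x y. x > y" xs i j] that len by simp
    qed
    define \<pi> where "\<pi> i = (if i < m then inv_into {..<m} g (xs ! i) else i)" for i
    have g\<pi>: "g (\<pi> i) = xs ! i" "\<pi> i < m" if "i < m" for i
    proof -
      have "xs ! i \<in> g ` {..<m}"
        using that len set nth_mem by metis
      then show "g (\<pi> i) = xs ! i" "\<pi> i < m"
        using f_inv_into_f[of "xs ! i" g "{..<m}"] inv_into_into[of "xs ! i" g "{..<m}"] that by (auto simp: \<pi>_def)
    qed
    have "inj_on \<pi> {0..<m}"
    proof (rule inj_onI)
      fix i j assume ij: "i \<in> {0..<m}" "j \<in> {0..<m}" "\<pi> i = \<pi> j"
      then have "xs ! i = xs ! j"
        using g\<pi>(1)[of i] g\<pi>(1)[of j] by simp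
      then show "i = j"
        using ij nth_eq_iff_index_eq[OF dist] len by simp
    qed
    moreover have "\<pi> ` {0..<m} \<subseteq> {0..<m}"
      using g\<pi> by auto
    ultimately have "bij_betw \<pi> {0..<m} {0..<m}"
      by (simp add: bij_betw_def endo_inj_surj)
    then have perm: "\<pi> permutes {0..<m}"
      by (rule bij_imp_permutes) (simp add: \<pi>_def)
    \<comment> \<open>The last value exceeds \<open>- m\<close>, and each step to the left raises it
      by at least one; this makes the parts of \<open>\<rho>\<close> non-negative.\<close>
    have low: "xs ! i \<ge> - int i" if "i < m" for i
    proof -
      have "xs ! (m - 1 - d) \<ge> - int (m - 1 - d)" if "d < m" for d
        using that
      proof (induction d)
        case 0
        have "xs ! (m - 1) \<in> g ` {..<m}"
          using 0 len set nth_mem[of "m - 1" xs] by simp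
        with True 0 show ?case
          by auto
      next
        case (Suc d)
        have "m - 1 - Suc d < m - 1 - d" "m - 1 - d < m"
          using Suc.prems by linarith+
        from desc[OF this] Suc show ?case
          by (simp add: of_nat_diff)
      qed
      from this[of "m - 1 - i"] that show ?thesis
        by simp
    qed
    define \<rho> where "\<rho> i = (if i < m then nat (xs ! i + int i) else 0)" for i
    have "det (mat m m (\<lambda>(i, j). A $$ (\<pi> i, j))) = of_int (sign \<pi>) * det A"
      by (rule det_permute_rows[OF A perm])
    also have "mat m m (\<lambda>(i, j). A $$ (\<pi> i, j)) = mat m m (\<lambda>(i, j). \<sigma> (int (\<rho> i) + int j - int i))"
    proof (rule eq_matI)
      fix i j assume ij: "i < dim_row (mat m m (\<lambda>(i, j). \<sigma> (int (\<rho> i) + int j - int i)))"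
        "j < dim_col (mat m m (\<lambda>(i, j). \<sigma> (int (\<rho> i) + int j - int i)))"
      then show "mat m m (\<lambda>(i, j). A $$ (\<pi> i, j)) $$ (i, j) =
          mat m m (\<lambda>(i, j). \<sigma> (int (\<rho> i) + int j - int i)) $$ (i, j)"
        using g\<pi>[of i] low[of i] by (simp add: A_def \<rho>_def add.commute)
    qed auto
    finally have "of_int (sign \<pi>) * det A = jt_det \<sigma> m (\<lambda>i. int (\<rho> i))"
      by (simp add: jt_det_def)
    then have "det A = jt_det \<sigma> m (\<lambda>i. int (\<rho> i)) \<or> det A = - jt_det \<sigma> m (\<lambda>i. int (\<rho> i))"
      by (cases \<pi> rule: sign_cases) (auto dest: arg_cong[where f = uminus])
    moreover have "\<rho> (Suc i) \<le> \<rho> i" for i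
      using desc[of i "Suc i"] by (auto simp: \<rho>_def)
    moreover have "\<rho> 0 < k" if "m \<ge> 1"
    proof -
      have "xs ! 0 \<in> g ` {..<m}"
        using that len set nth_mem[of 0 xs] by simp
      then have "xs ! 0 < int k"
        using le by (force simp: g_def)
      with that low[of 0] show ?thesis
        by (simp add: \<rho>_def)
    qed
    ultimately show ?thesis
      unfolding D by (intro disjI2 exI[of _ \<rho>]) (auto simp: \<rho>_def)
  qed
qed

end

section \<open>Coordinates with respect to a positive deformation\<close>

text \<open>Zero-padded functions allow rows to be added or dropped without changing the
  partition.\<close>

definition box_funs :: "nat \<Rightarrow> nat \<Rightarrow> (nat \<Rightarrow> nat) set" where
  "box_funs m k = {a. (\<forall>i. a (Suc i) \<le> a i) \<and> a 0 \<le> k \<and> (\<forall>i\<ge>m. a i = 0)}"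

lemma box_funs_antimono: "a \<in> box_funs m k \<Longrightarrow> i \<le> j \<Longrightarrow> a j \<le> a i"
  unfolding box_funs_def by (rule lift_Suc_antimono_le[where f = a]) auto

lemma box_funs_le: "a \<in> box_funs m k \<Longrightarrow> a i \<le> k"
  using box_funs_antimono[of a m k 0 i] by (auto simp: box_funs_def)

lemma box_funs_eq_0: "a \<in> box_funs m k \<Longrightarrow> i \<ge> m \<Longrightarrow> a i = 0"
  by (auto simp: box_funs_def)

lemma finite_box_funs: "finite (box_funs m k)"
proof (rule finite_subset)
  show "box_funs m k \<subseteq> {a. \<forall>i. (i \<in> {..<m} \<longrightarrow> a i \<in> {..k}) \<and> (i \<notin> {..<m} \<longrightarrow> a i = 0)}"
    by (auto simp: box_funs_eq_0 intro: box_funs_le)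
qed (rule finite_set_of_finite_funs; simp)

text \<open>Here \<open>crd x \<nu>\<close> stands for the coefficient in $\mathbb{Q}[q]$ of $\tau_\nu$ in the class of \<open>x\<close>, and
  \<open>\<theta> q\<close> with \<open>\<theta> = \<plusminus>\<alpha>\<close> for the class of $\sigma_n$.\<close>

locale positive_deformation = complete_sequence m e \<sigma>
  for m :: nat and e :: "nat \<Rightarrow> 'r :: comm_ring_1" and \<sigma> :: "int \<Rightarrow> 'r" +
  fixes k n :: nat and \<theta> :: rat and emb :: "rat poly \<Rightarrow> 'r"
    and t :: "(nat \<Rightarrow> nat) \<Rightarrow> 'r" and crd :: "'r \<Rightarrow> (nat \<Rightarrow> nat) \<Rightarrow> rat poly"
  assumes m_pos: "m \<ge> 1" and k_pos: "k \<ge> 1" and n_eq: "n = m + k"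
    and crd_add: "crd (x + y) \<nu> = crd x \<nu> + crd y \<nu>"
    and crd_emb: "crd (emb f * x) \<nu> = f * crd x \<nu>"
    and crd_t: "\<mu> \<in> box_funs m k \<Longrightarrow> \<nu> \<in> box_funs m k \<Longrightarrow> crd (t \<mu>) \<nu> = of_bool (\<mu> = \<nu>)"
    and crd_0_mult: "(\<And>\<nu>. \<nu> \<in> box_funs m k \<Longrightarrow> crd x \<nu> = 0) \<Longrightarrow> \<nu> \<in> box_funs m k \<Longrightarrow> crd (x * y) \<nu> = 0"
    and crd_\<sigma>_small: "int k < j \<Longrightarrow> j < int n \<Longrightarrow> \<nu> \<in> box_funs m k \<Longrightarrow> crd (\<sigma> j) \<nu> = 0"
    and crd_\<sigma>_n: "\<nu> \<in> box_funs m k \<Longrightarrow> crd (\<sigma> (int n) * y) \<nu> = [:0, \<theta>:] * crd y \<nu>"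
    and crd_t_mult_nonneg: "\<kappa> \<in> box_funs m k \<Longrightarrow> \<mu> \<in> box_funs m k \<Longrightarrow> \<nu> \<in> box_funs m k \<Longrightarrow>
          poly.coeff (crd (t \<kappa> * t \<mu>) \<nu>) i \<ge> 0"
    and crd_s_homogeneous: "\<mu> \<in> box_funs m k \<Longrightarrow> \<nu> \<in> box_funs m k \<Longrightarrow>
          poly.coeff (crd (jt_det \<sigma> m (\<lambda>i. int (\<mu> i))) \<nu>) i \<noteq> 0 \<Longrightarrow>
          (\<Sum>i<m. \<mu> i) = (\<Sum>i<m. \<nu> i) + n * i"
    and crd_s_coeff_0: "\<mu> \<in> box_funs m k \<Longrightarrow> \<nu> \<in> box_funs m k \<Longrightarrow>
          poly.coeff (crd (jt_det \<sigma> m (\<lambda>i. int (\<mu> i))) \<nu>) 0 = of_bool (\<mu> = \<nu>)"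
begin

abbreviation P :: "(nat \<Rightarrow> nat) set" where
  "P \<equiv> box_funs m k"

abbreviation s :: "(nat \<Rightarrow> nat) \<Rightarrow> 'r" where
  "s a \<equiv> jt_det \<sigma> m (\<lambda>i. int (a i))"

section \<open>Linearity of the coordinates and congruence of representatives\<close>

lemma crd_0 [simp]: "crd 0 \<nu> = 0"
  using crd_add[of 0 0 \<nu>] by simp

lemma crd_uminus: "crd (- x) \<nu> = - crd x \<nu>"
  using crd_add[of x "- x" \<nu>] by (simp add: eq_neg_iff_add_eq_0 add.commute)

lemma crd_diff: "crd (x - y) \<nu> = crd x \<nu> - crd y \<nu>"
  using crd_add[of x "- y" \<nu>] by (simp add: crd_uminus)

lemma crd_sum: "crd (sum f A) \<nu> = (\<Sum>i\<in>A. crd (f i) \<nu>)"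
  by (induction A rule: infinite_finite_induct) (auto simp: crd_add)

text \<open>Equality of classes in the quotient, expressed through coordinates. The assumption
  \<open>crd_0_mult\<close> makes it compatible with products, so all computations stay in the ring
  of representatives.\<close>

definition cong :: "'r \<Rightarrow> 'r \<Rightarrow> bool" where
  "cong x y \<longleftrightarrow> (\<forall>\<nu>\<in>P. crd x \<nu> = crd y \<nu>)"

lemma cong_refl [intro, simp]: "cong x x"
  by (simp add: cong_def)

lemma cong_sym: "cong x y \<Longrightarrow> cong y x"
  by (simp add: cong_def)

lemma cong_trans [trans]: "cong x y \<Longrightarrow> cong y z \<Longrightarrow> cong x z"
  by (simp add: cong_def)

lemma cong_uminus: "cong x y \<Longrightarrow> cong (- x) (- y)"
  by (simp add: cong_def crd_uminus)

lemma cong_sum: "(\<And>i. i \<in> A \<Longrightarrow> cong (f i) (g i)) \<Longrightarrow> cong (sum f A) (sum g A)"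
  unfolding cong_def crd_sum by (auto intro!: sum.cong)

lemma cong_mult_right: "cong x y \<Longrightarrow> cong (x * z) (y * z)"
  unfolding cong_def using crd_0_mult[of "x - y" _ z] by (auto simp: crd_diff left_diff_distrib)

lemma cong_mult_left: "cong x y \<Longrightarrow> cong (z * x) (z * y)"
  using cong_mult_right[of x y z] by (simp add: mult.commute)

lemma cong_mult: "cong x y \<Longrightarrow> cong x' y' \<Longrightarrow> cong (x * x') (y * y')"
  using cong_trans[OF cong_mult_right cong_mult_left] .

lemma cong_prod: "(\<And>i. i \<in> A \<Longrightarrow> cong (f i) (g i)) \<Longrightarrow> cong (prod f A) (prod g A)"
  by (induction A rule: infinite_finite_induct) (auto intro: cong_mult)

lemma cong_jt_det:
  assumes "\<And>i j. i < N \<Longrightarrow> j < N \<Longrightarrow> cong (H (a i + int j - int i)) (H' (b i + int j - int i))"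
  shows "cong (jt_det H N a) (jt_det H' N b)"
  unfolding jt_det_expand
proof (intro cong_sum cong_mult_left cong_prod)
  fix \<pi> i assume "\<pi> \<in> {\<pi>. \<pi> permutes {0..<N}}" "i \<in> {0..<N}"
  then show "cong (H (a i + int (\<pi> i) - int i)) (H' (b i + int (\<pi> i) - int i))"
    using permutes_in_image[of \<pi> "{0..<N}" i] by (intro assms) auto
qed

lemma crd_mult_expand:
  assumes "\<nu> \<in> P"
  shows "crd (x * y) \<nu> = (\<Sum>\<mu>\<in>P. crd x \<mu> * crd (t \<mu> * y) \<nu>)"
proof -
  have "cong x (\<Sum>\<mu>\<in>P. emb (crd x \<mu>) * t \<mu>)"
    by (auto simp: cong_def crd_sum crd_emb crd_t finite_box_funs
        of_bool_def if_distrib[where f = "\<lambda>c. _ * c"] cong: if_cong)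
  then have "cong (x * y) ((\<Sum>\<mu>\<in>P. emb (crd x \<mu>) * t \<mu>) * y)"
    by (rule cong_mult_right)
  with assms show ?thesis
    by (simp add: cong_def sum_distrib_right mult.assoc crd_sum crd_emb)
qed

subsection \<open>Quantum Pieri rule\<close>

lemma cong_\<sigma>_small: "int k < j \<Longrightarrow> j < int n \<Longrightarrow> cong (\<sigma> j) 0"
  by (simp add: cong_def crd_\<sigma>_small)

text \<open>Both sides satisfy the same recursion of order \<open>m\<close> for
  \<open>j \<ge> 1\<close> and agree at the \<open>m\<close> initial places
  \<open>- m < j \<le> 0\<close>: for \<open>j < 0\<close> both are congruent to 0, and
  \<open>\<sigma> 0 = 1\<close>.\<close>

lemma cong_\<sigma>_shift:
  assumes "j > - int m"
  shows "cong (\<sigma> (int n + j)) (\<sigma> (int n) * \<sigma> j)"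
  using assms
proof (induction "nat (j + int m)" arbitrary: j rule: less_induct)
  case less
  show ?case
  proof (cases "j \<le> 0")
    case True
    with less.prems show ?thesis
      using cong_\<sigma>_small[of "int n + j"] by (cases "j = 0") (auto simp: \<sigma>_0 \<sigma>_neg n_eq)
  next
    case False
    have rec: "\<sigma> x = - (\<Sum>i\<in>{1..m}. (-1) ^ i * e i * \<sigma> (x - int i))" if "x \<ge> 1" for x
    proof -
      have "{..m} = insert 0 {1..m}"
        by auto
      then show ?thesis
        using \<sigma>_rec[OF that] by (simp add: e_0 eq_neg_iff_add_eq_0)
    qed
    have "cong (- (\<Sum>i\<in>{1..m}. (-1) ^ i * e i * \<sigma> (int n + (j - int i))))
        (- (\<Sum>i\<in>{1..m}. (-1) ^ i * e i * (\<sigma> (int n) * \<sigma> (j - int i))))"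
      using False by (intro cong_uminus cong_sum cong_mult_left less.hyps) auto
    also have "- (\<Sum>i\<in>{1..m}. (-1) ^ i * e i * (\<sigma> (int n) * \<sigma> (j - int i))) = \<sigma> (int n) * \<sigma> j"
      using False by (subst (2) rec) (auto simp: sum_distrib_left mult_ac)
    also have "- (\<Sum>i\<in>{1..m}. (-1) ^ i * e i * \<sigma> (int n + (j - int i))) = \<sigma> (int n + j)"
      using False by (subst (2) rec) (auto simp: add_diff_eq)
    finally show ?thesis .
  qed
qed

definition strips :: "(nat \<Rightarrow> nat) \<Rightarrow> nat \<Rightarrow> (nat \<Rightarrow> nat) set" where
  "strips a p = {b \<in> hstrips (m - 1) a p. b 0 \<le> k}"

lemma strips_subset: "a \<in> P \<Longrightarrow> strips a p \<subseteq> P"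
proof
  fix b assume a: "a \<in> P" and "b \<in> strips a p"
  then have b: "b 0 \<le> k" "\<forall>i>m - 1. b i = 0" "a 0 \<le> b 0"
    "\<forall>i<m - 1. a (Suc i) \<le> b (Suc i) \<and> b (Suc i) \<le> a i"
    by (auto simp: strips_def hstrips_def)
  have "b (Suc i) \<le> b i" for i
  proof (cases "i < m - 1")
    case True
    have "a i \<le> b i"
      using True b by (cases i) auto
    with b True show ?thesis
      using order_trans by blast
  qed (use b in auto)
  with b m_pos show "b \<in> P"
    by (auto simp: box_funs_def)
qed

lemma finite_strips: "a \<in> P \<Longrightarrow> finite (strips a p)"
  using finite_subset[OF strips_subset finite_box_funs] .

text \<open>All entries have index below \<open>n\<close>, so \<open>\<sigma>\<close> may be
  replaced by its truncation \<open>H\<close> above \<open>k\<close>. The rule \<open>pieri\<close>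
  holds for any sequence that vanishes at negative indices, hence for \<open>H\<close>, and leads
  from \<open>m - 1\<close> to \<open>m\<close> rows without losing any strip. For \<open>H\<close>,
  a strip that leaves the box has a zero first row.\<close>

lemma pieri_short:
  assumes a: "a \<in> P" and am: "a (m - 1) = 0" and p: "p \<le> k"
  shows "cong (\<sigma> (int p) * s a) (\<Sum>b\<in>strips a p. s b)"
proof -
  define H where "H x = (if x \<le> int k then \<sigma> x else 0)" for x
  have H: "cong (\<sigma> x) (H x)" if "x < int n" for x
    using cong_\<sigma>_small[of x] that by (auto simp: H_def)
  have "s a = jt_det \<sigma> (m - 1) (\<lambda>i. int (a i))"
    using jt_det_last_row_zero[where H = \<sigma>, OF \<sigma>_0 \<sigma>_neg, of "\<lambda>i. int (a i)" "m - 1"] am m_pos by simp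
  also have "cong \<dots> (jt_det H (m - 1) (\<lambda>i. int (a i)))"
  proof (intro cong_jt_det H)
    fix i j assume "i < m - 1" "j < m - 1"
    then show "int (a i) + int j - int i < int n"
      using box_funs_le[OF a, of i] by (simp add: n_eq)
  qed
  finally have "cong (\<sigma> (int p) * s a) (\<sigma> (int p) * jt_det H (m - 1) (\<lambda>i. int (a i)))"
    by (rule cong_mult_left)
  also have "\<sigma> (int p) * jt_det H (m - 1) (\<lambda>i. int (a i)) =
      (\<Sum>b\<in>hstrips (m - 1) a p. jt_det H (Suc (m - 1)) (\<lambda>i. int (b i)))"
  proof -
    have "H (int p) * jt_det H (m - 1) (\<lambda>i. int (a i)) =
      (\<Sum>b\<in>hstrips (m - 1) a p. jt_det H (Suc (m - 1)) (\<lambda>i. int (b i)))"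
      using box_funs_antimono[OF a] am
      by (intro pieri) (auto simp: H_def \<sigma>_neg)
    then show ?thesis
      using p by (simp add: H_def)
  qed
  also have "\<dots> = (\<Sum>b\<in>strips a p. jt_det H m (\<lambda>i. int (b i)))"
  proof (rule sum.mono_neutral_cong_right)
    have "jt_det H m (\<lambda>i. int (b i)) = 0" if "b 0 > k" for b
    proof -
      have "(\<Prod>i = 0..<m. H (int (b i) + int (\<pi> i) - int i)) = 0" for \<pi>
        using that m_pos by (intro prod_zero bexI[of _ 0]) (auto simp: H_def)
      then show ?thesis
        by (simp add: jt_det_expand)
    qed
    then show "\<forall>b\<in>hstrips (m - 1) a p - strips a p. jt_det H (Suc (m - 1)) (\<lambda>i. int (b i)) = 0"
      using m_pos by (auto simp: strips_def not_le)
  qed (use m_pos in \<open>auto simp: strips_def finite_hstrips\<close>)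
  also have "cong \<dots> (\<Sum>b\<in>strips a p. s b)"
  proof (intro cong_sum cong_jt_det cong_sym[OF H])
    fix b i j assume "b \<in> strips a p" "i < m" "j < m"
    then show "int (b i) + int j - int i < int n"
      using box_funs_le[OF subsetD[OF strips_subset[OF a]], of b p i] by (simp add: n_eq)
  qed
  finally show ?thesis .
qed

text \<open>A partition with first part above \<open>k\<close> reduces to \<open>\<plusminus>\<theta> q s \<rho>\<close> with \<open>\<rho> 0 < k\<close>: such a \<open>\<rho>\<close> cannot grow
  into the point class by the remaining multiplications.\<close>

lemma crd_s_wide:
  assumes a: "a \<in> P" and p: "p \<le> k" and b: "b \<in> hstrips (m - 1) a p" "b 0 > k"
  shows "(\<forall>y. \<forall>\<nu>\<in>P. crd (y * s b) \<nu> = 0) \<or> (\<exists>\<rho>\<in>P. \<rho> 0 < k \<and>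
    ((\<forall>y. \<forall>\<nu>\<in>P. crd (y * s b) \<nu> = [:0, \<theta>:] * crd (y * s \<rho>) \<nu>) \<or>
     (\<forall>y. \<forall>\<nu>\<in>P. crd (y * s b) \<nu> = - [:0, \<theta>:] * crd (y * s \<rho>) \<nu>)))"
proof -
  \<comment> \<open>The indices in row 0 are at least \<open>b 0 > n - m\<close>, so
    \<open>cong_\<sigma>_shift\<close> takes the common factor \<open>\<sigma> (int n)\<close> out
    of this row and lowers its indices by \<open>n\<close>.\<close>
  define f where "f i = (if i = 0 then int (b 0) - int n else int (b i))" for i
  have b_le: "b i \<le> k" if "i \<ge> 1" for i
  proof (cases "i \<le> m - 1")
    case True
    with that b have "b i \<le> a (i - 1)"
      by (cases i) (auto simp: hstrips_def)
    then show ?thesis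
      using box_funs_le[OF a, of "i - 1"] by simp
  qed (use b in \<open>auto simp: hstrips_def\<close>)
  \<comment> \<open>Row 0 grows by at most \<open>p \<le> k\<close> boxes. Hence
    \<open>b 0 - n\<close> is at most \<open>k - m\<close>, which meets the bound
    \<open>k - 1\<close> of the straightening.\<close>
  have b0: "b 0 \<le> 2 * k"
  proof -
    have "(\<Sum>i\<le>m - 1. a i) - a 0 = (\<Sum>i\<in>{1..m - 1}. a i)" "(\<Sum>i\<le>m - 1. b i) - b 0 = (\<Sum>i\<in>{1..m - 1}. b i)"
      by (simp_all add: atMost_atLeast0 sum.atLeast_Suc_atMost)
    moreover have "(\<Sum>i\<in>{1..m - 1}. a i) \<le> (\<Sum>i\<in>{1..m - 1}. b i)"
    proof (rule sum_mono)
      fix i assume "i \<in> {1..m - 1}"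
      then show "a i \<le> b i"
        using b by (cases i) (auto simp: hstrips_def)
    qed
    moreover have "a 0 \<le> (\<Sum>i\<le>m - 1. a i)" "b 0 \<le> (\<Sum>i\<le>m - 1. b i)"
      by (rule member_le_sum; simp)+
    moreover have "(\<Sum>i\<le>m - 1. b i) = (\<Sum>i\<le>m - 1. a i) + p"
      using b by (simp add: hstrips_def)
    ultimately show ?thesis
      using box_funs_le[OF a, of 0] p by linarith
  qed
  have "cong (s b) (\<sigma> (int n) * jt_det \<sigma> m f)"
    unfolding jt_det_expand sum_distrib_left
  proof (rule cong_sum)
    fix \<pi> assume "\<pi> \<in> {\<pi>. \<pi> permutes {0..<m}}"
    have first: "(\<Prod>i = 0..<m. F i) = F 0 * (\<Prod>i = Suc 0..<m. F i)" for F :: "nat \<Rightarrow> 'r"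
      using m_pos by (simp add: prod.atLeast_Suc_lessThan)
    have "cong (\<sigma> (int (b 0) + int (\<pi> 0) - int 0)) (\<sigma> (int n) * \<sigma> (f 0 + int (\<pi> 0) - int 0))"
      using cong_\<sigma>_shift[of "f 0 + int (\<pi> 0)"] b(2) by (simp add: f_def n_eq)
    then have "cong (\<Prod>i = 0..<m. \<sigma> (int (b i) + int (\<pi> i) - int i))
        (\<sigma> (int n) * \<sigma> (f 0 + int (\<pi> 0) - int 0) * (\<Prod>i = Suc 0..<m. \<sigma> (int (b i) + int (\<pi> i) - int i)))"
      unfolding first by (rule cong_mult_right)
    also have "(\<Prod>i = Suc 0..<m. \<sigma> (int (b i) + int (\<pi> i) - int i)) =
        (\<Prod>i = Suc 0..<m. \<sigma> (f i + int (\<pi> i) - int i))"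
      by (intro prod.cong) (auto simp: f_def)
    finally have "cong (\<Prod>i = 0..<m. \<sigma> (int (b i) + int (\<pi> i) - int i))
        (\<sigma> (int n) * (\<Prod>i = 0..<m. \<sigma> (f i + int (\<pi> i) - int i)))"
      by (simp add: first mult.assoc)
    then show "cong (of_int (sign \<pi>) * (\<Prod>i = 0..<m. \<sigma> (int (b i) + int (\<pi> i) - int i)))
        (\<sigma> (int n) * (of_int (sign \<pi>) * (\<Prod>i = 0..<m. \<sigma> (f i + int (\<pi> i) - int i))))"
      by (subst mult.left_commute) (rule cong_mult_left)
  qed
  then have "cong (y * s b) (\<sigma> (int n) * (y * jt_det \<sigma> m f))" for y
    using cong_mult_left[of "s b" _ y] by (simp add: mult.left_commute)
  then have crd_b: "crd (y * s b) \<nu> = [:0, \<theta>:] * crd (y * jt_det \<sigma> m f) \<nu>" if "\<nu> \<in> P" for y \<nu>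
    using that crd_\<sigma>_n[OF that] by (simp add: cong_def)
  have "f i - int i \<le> int k - 1" if "i < m" for i
    using that b0 b_le[of i] m_pos k_pos by (auto simp: f_def n_eq)
  from jt_det_straighten[OF this] consider "jt_det \<sigma> m f = 0"
    | \<rho> where "\<forall>i. \<rho> (Suc i) \<le> \<rho> i" "\<forall>i\<ge>m. \<rho> i = 0" "\<rho> 0 < k"
       "jt_det \<sigma> m f = s \<rho> \<or> jt_det \<sigma> m f = - s \<rho>"
    using m_pos by blast
  then show ?thesis
  proof cases
    case 1
    then show ?thesis
      using crd_b by simp
  next
    case 2
    then have "\<rho> \<in> P"
      by (simp add: box_funs_def)
    moreover from 2(4) have "(\<forall>y. \<forall>\<nu>\<in>P. crd (y * s b) \<nu> = [:0, \<theta>:] * crd (y * s \<rho>) \<nu>) \<or>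
     (\<forall>y. \<forall>\<nu>\<in>P. crd (y * s b) \<nu> = - [:0, \<theta>:] * crd (y * s \<rho>) \<nu>)"
    proof
      assume "jt_det \<sigma> m f = s \<rho>"
      then show ?thesis
        using crd_b by simp
    next
      assume *: "jt_det \<sigma> m f = - s \<rho>"
      show ?thesis
        using crd_b unfolding * by (simp add: crd_uminus)
    qed
    ultimately show ?thesis
      using 2(3) by blast
  qed
qed

lemma crd_pieri:
  assumes a: "a \<in> P" and p: "p \<le> k" and \<nu>: "\<nu> \<in> P"
  shows "crd (y * (\<sigma> (int p) * s a)) \<nu> = (\<Sum>b\<in>strips a p. crd (y * s b) \<nu>) +
    (\<Sum>b | b \<in> hstrips (m - 1) a p \<and> b 0 > k. crd (y * s b) \<nu>)"
proof -
  have "\<sigma> (int p) * s a = (\<Sum>b\<in>hstrips (m - 1) a p. s b)"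
    using a m_pos by (intro pieri_bounded_length) (auto simp: box_funs_def)
  then have "crd (y * (\<sigma> (int p) * s a)) \<nu> = (\<Sum>b\<in>hstrips (m - 1) a p. crd (y * s b) \<nu>)"
    by (simp add: sum_distrib_left crd_sum)
  also have "hstrips (m - 1) a p = strips a p \<union> {b \<in> hstrips (m - 1) a p. b 0 > k}"
    by (auto simp: strips_def)
  also have "(\<Sum>b\<in>\<dots>. crd (y * s b) \<nu>) = (\<Sum>b\<in>strips a p. crd (y * s b) \<nu>) +
    (\<Sum>b | b \<in> hstrips (m - 1) a p \<and> b 0 > k. crd (y * s b) \<nu>)"
    by (rule sum.union_disjoint) (use finite_hstrips in \<open>auto simp: strips_def\<close>)
  finally show ?thesis .
qed

subsection \<open>The coefficient of the point class\<close>

definition pt :: "nat \<Rightarrow> nat" where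
  "pt i = (if i < m then k else 0)"

lemma pt_in_P: "pt \<in> P"
  by (auto simp: pt_def box_funs_def)

definition h :: "nat list \<Rightarrow> 'r" where
  "h ps = prod_list (map (\<lambda>p. \<sigma> (int p)) ps)"

lemma h_Nil [simp]: "h [] = 1"
  by (simp add: h_def)

lemma h_Cons: "h (p # ps) * y = h ps * (\<sigma> (int p) * y)"
  by (simp add: h_def mult_ac)

text \<open>The bound on the degree excludes every positive power of q.\<close>

lemma crd_s_eqI:
  assumes \<mu>: "\<mu> \<in> P" and \<nu>: "\<nu> \<in> P" and le: "(\<Sum>i<m. \<mu> i) < (\<Sum>i<m. \<nu> i) + n"
  shows "crd (s \<mu>) \<nu> = of_bool (\<mu> = \<nu>)"
proof (rule poly_eqI)
  fix i
  show "poly.coeff (crd (s \<mu>) \<nu>) i = poly.coeff (of_bool (\<mu> = \<nu>)) i"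
  proof (cases "i = 0")
    case False
    then have "(\<Sum>i<m. \<mu> i) \<noteq> (\<Sum>i<m. \<nu> i) + n * i"
      using le by (cases i) auto
    then have "poly.coeff (crd (s \<mu>) \<nu>) i = 0"
      using crd_s_homogeneous[OF \<mu> \<nu>] by blast
    with False show ?thesis
      by (cases i) auto
  qed (use crd_s_coeff_0[OF \<mu> \<nu>] in auto)
qed

lemma crd_s_pt: "b \<in> P \<Longrightarrow> crd (s b) pt = of_bool (b = pt)"
proof (rule crd_s_eqI[OF _ pt_in_P])
  assume "b \<in> P"
  then have "(\<Sum>i<m. b i) \<le> (\<Sum>i<m. pt i)"
    by (intro sum_mono) (auto simp: pt_def box_funs_le)
  with m_pos n_eq show "(\<Sum>i<m. b i) < (\<Sum>i<m. pt i) + n"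
    by linarith
qed

lemma eq_pt_iff: "b \<in> P \<Longrightarrow> b = pt \<longleftrightarrow> (\<forall>i<m. b i = k)"
  by (auto simp: pt_def fun_eq_iff box_funs_eq_0)

text \<open>The last clause carries the induction. In a horizontal strip the new row
  \<open>i + 1\<close> is bounded by the old row \<open>i\<close>, so a deficient row among the
  first \<open>m - length ps\<close> still leaves a deficient row after all strips. Partitions that
  leave the box reduce, with a factor \<open>\<plusminus>\<theta>\<close> q, to some
  \<open>\<rho>\<close> with \<open>\<rho> 0 < k\<close>; the clause makes their contribution zero,
  whatever the sign.\<close>

lemma crd_h_s_pt:
  assumes "length ps \<le> m" and "set ps \<subseteq> {..k}" and "b \<in> P"
  shows "\<exists>r\<ge>0. crd (h ps * s b) pt = [:r:] \<and> ((\<exists>i<m - length ps. b i \<noteq> k) \<longrightarrow> r = 0)"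
  using assms
proof (induction ps arbitrary: b)
  case Nil
  then show ?case
    by (intro exI[of _ "of_bool (b = pt)"]) (auto simp: crd_s_pt eq_pt_iff)
next
  case (Cons p ps)
  define r where "r = m - length ps"
  \<comment> \<open>As \<open>p # ps\<close> has at most \<open>m\<close> factors, the clause for
    the remaining \<open>ps\<close> covers row 0.\<close>
  have r: "r \<ge> 1" "m - length (p # ps) = r - 1"
    using Cons.prems by (auto simp: r_def)
  have IH: "\<exists>x\<ge>0. crd (h ps * s b') pt = [:x:] \<and> ((\<exists>i<r. b' i \<noteq> k) \<longrightarrow> x = 0)" if "b' \<in> P" for b'
    using Cons.IH[OF _ _ that] Cons.prems by (simp add: r_def)
  have wide: "crd (h ps * s b') pt = 0" if b': "b' \<in> hstrips (m - 1) b p" "b' 0 > k" for b'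
  proof -
    have 0: "crd (h ps * s \<rho>) pt = 0" if "\<rho> \<in> P" "\<rho> 0 < k" for \<rho>
      using IH[OF that(1)] that(2) r(1) by force
    have "p \<le> k"
      using Cons.prems by simp
    from crd_s_wide[OF Cons.prems(3) this b'] show ?thesis
      using pt_in_P by (auto simp: 0)
  qed
  from IH obtain x where x: "\<And>b'. b' \<in> P \<Longrightarrow> x b' \<ge> 0"
    "\<And>b'. b' \<in> P \<Longrightarrow> crd (h ps * s b') pt = [:x b':]"
    "\<And>b' i. b' \<in> P \<Longrightarrow> i < r \<Longrightarrow> b' i \<noteq> k \<Longrightarrow> x b' = 0"
    by metis
  have sum_const: "(\<Sum>b'\<in>A. [:x b':]) = [:\<Sum>b'\<in>A. x b':]" for A
    by (induction A rule: infinite_finite_induct) auto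
  have sub: "strips b p \<subseteq> P"
    by (rule strips_subset) (rule Cons.prems)
  have "crd (h (p # ps) * s b) pt = (\<Sum>b'\<in>strips b p. crd (h ps * s b') pt)"
    unfolding h_Cons using Cons.prems by (subst crd_pieri) (auto simp: pt_in_P wide)
  also have "\<dots> = (\<Sum>b'\<in>strips b p. [:x b':])"
    using sub by (intro sum.cong) (auto simp: x)
  also have "\<dots> = [:\<Sum>b'\<in>strips b p. x b':]"
    by (rule sum_const)
  finally have "crd (h (p # ps) * s b) pt = [:\<Sum>b'\<in>strips b p. x b':]" .
  moreover have "(\<Sum>b'\<in>strips b p. x b') \<ge> 0"
    using sub x(1) by (intro sum_nonneg) auto
  moreover have "(\<Sum>b'\<in>strips b p. x b') = 0" if i: "i < r - 1" "b i \<noteq> k" for i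
  proof (rule sum.neutral, rule ballI)
    fix b' assume b': "b' \<in> strips b p"
    then have "b' (Suc i) \<le> b i"
      using i by (auto simp: strips_def hstrips_def r_def)
    also have "\<dots> < k"
      using i box_funs_le[OF Cons.prems(3), of i] by simp
    finally show "x b' = 0"
      using x(3)[of b' "Suc i"] sub b' i by auto
  qed
  ultimately show ?case
    unfolding r(2) by auto
qed

text \<open>One factor completes one row: below full rows, the next row \<open>l\<close> is filled
  by a single strip of \<open>k - b l\<close> boxes. The other strips contribute non-negative
  amounts by \<open>crd_h_s_pt\<close>, so nothing cancels.\<close>

lemma exists_h_s_pt_pos:
  assumes "r \<le> m" and "b \<in> P" and "\<And>i. i < m - r \<Longrightarrow> b i = k"
  shows "\<exists>ps. length ps = r \<and> set ps \<subseteq> {..k} \<and> poly.coeff (crd (h ps * s b) pt) 0 > 0"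
  using assms
proof (induction r arbitrary: b)
  case 0
  then show ?case
    using eq_pt_iff[of b] by (auto simp: crd_s_pt)
next
  case (Suc r)
  define l where "l = m - Suc r"
  define p where "p = k - b l"
  define b' where "b' = b(l := k)"
  have l: "l < m" "m - r = Suc l"
    using Suc.prems by (auto simp: l_def)
  have k: "b i = k" if "i < l" for i
    using Suc.prems(3) that by (simp add: l_def)
  have "(\<Sum>i\<le>m - 1. b' i) = (\<Sum>i\<le>m - 1. b i) + p"
  proof -
    have "(\<Sum>i\<le>m - 1. c i) = c l + (\<Sum>i\<in>{..m - 1} - {l}. c i)" for c :: "nat \<Rightarrow> nat"
      using l by (intro sum.remove) auto
    moreover have "(\<Sum>i\<in>{..m - 1} - {l}. b' i) = (\<Sum>i\<in>{..m - 1} - {l}. b i)"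
      by (intro sum.cong) (auto simp: b'_def)
    ultimately show ?thesis
      using box_funs_le[OF Suc.prems(2), of l] by (simp add: b'_def p_def)
  qed
  moreover have "b (Suc i) \<le> b i" "b i \<le> k" "i \<ge> m \<Longrightarrow> b i = 0" for i
    using Suc.prems(2) box_funs_le[OF Suc.prems(2), of i] by (auto simp: box_funs_def)
  ultimately have b': "b' \<in> strips b p"
    using l k by (auto simp: strips_def hstrips_def b'_def)
  have p: "p \<le> k"
    by (simp add: p_def)
  have b'P: "b' \<in> P"
    using strips_subset[OF Suc.prems(2)] b' by auto
  have "\<exists>ps. length ps = r \<and> set ps \<subseteq> {..k} \<and> poly.coeff (crd (h ps * s b') pt) 0 > 0"
    using Suc.prems(1) by (intro Suc.IH[OF _ b'P]) (auto simp: l less_Suc_eq b'_def k)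
  then obtain ps where ps: "length ps = r" "set ps \<subseteq> {..k}" "poly.coeff (crd (h ps * s b') pt) 0 > 0"
    by blast
  have nonneg: "poly.coeff (crd (h ps * s c) pt) 0 \<ge> 0" if "c \<in> P" for c
    using crd_h_s_pt[OF _ ps(2) that] ps(1) Suc.prems(1) by force
  have "poly.coeff (crd (h ps * s c) pt) 0 = 0" if "c \<in> hstrips (m - 1) b p" "c 0 > k" for c
    using crd_s_wide[OF Suc.prems(2) p that] pt_in_P by auto
  then have "poly.coeff (crd (h (p # ps) * s b) pt) 0 = (\<Sum>c\<in>strips b p. poly.coeff (crd (h ps * s c) pt) 0)"
    unfolding h_Cons using Suc.prems(2) p pt_in_P by (simp add: crd_pieri coeff_sum)
  also have "\<dots> > 0"
    using b' ps(3) nonneg strips_subset[OF Suc.prems(2)]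
    by (intro sum_pos2[OF finite_strips[OF Suc.prems(2)]]) auto
  finally show ?case
    using ps p by (intro exI[of _ "p # ps"]) auto
qed

subsection \<open>Rigidity\<close>

definition pos :: "'r \<Rightarrow> bool" where
  "pos x \<longleftrightarrow> (\<forall>\<nu>\<in>P. \<forall>i. poly.coeff (crd x \<nu>) i \<ge> 0)"

lemma pos_cong: "cong x y \<Longrightarrow> pos x \<longleftrightarrow> pos y"
  by (simp add: pos_def cong_def)

lemma pos_t: "\<mu> \<in> P \<Longrightarrow> pos (t \<mu>)"
  by (auto simp: pos_def crd_t)

lemma pos_mult_t:
  assumes "pos x" and "\<mu> \<in> P"
  shows "pos (t \<mu> * x)"
  unfolding pos_def
proof (intro ballI allI)
  fix \<nu> i assume "\<nu> \<in> P"
  then show "poly.coeff (crd (t \<mu> * x) \<nu>) i \<ge> 0"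
    using assms crd_t_mult_nonneg[of _ \<mu> \<nu>]
    by (subst mult.commute, subst crd_mult_expand)
       (auto simp: coeff_sum coeff_mult pos_def intro!: sum_nonneg mult_nonneg_nonneg)
qed

definition one_row :: "nat \<Rightarrow> nat \<Rightarrow> nat" where
  "one_row p i = (if i = 0 then p else 0)"

lemma one_row_in_P: "p \<le> k \<Longrightarrow> one_row p \<in> P"
  using m_pos by (auto simp: one_row_def box_funs_def)

lemma s_one_row: "s (one_row p) = \<sigma> (int p)"
proof -
  have "jt_det \<sigma> (Suc N) (\<lambda>i. int (one_row p i)) = \<sigma> (int p)" for N
  proof (induction N)
    case 0
    show ?case
      unfolding jt_det_def by (subst det_single) (auto simp: one_row_def)
  next
    case (Suc N)
    then show ?case
      by (subst jt_det_last_row_zero) (auto simp: \<sigma>_0 \<sigma>_neg one_row_def)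
  qed
  from this[of "m - 1"] m_pos show ?thesis
    by simp
qed

lemma cong_\<sigma>_t:
  assumes "p \<le> k"
  shows "cong (\<sigma> (int p)) (t (one_row p))"
  unfolding cong_def
proof
  fix \<nu> assume \<nu>: "\<nu> \<in> P"
  have "(\<Sum>i<m. one_row p i) = p"
    using m_pos by (simp add: one_row_def)
  then have "crd (s (one_row p)) \<nu> = of_bool (one_row p = \<nu>)"
    using assms m_pos n_eq by (intro crd_s_eqI one_row_in_P \<nu>) auto
  then show "crd (\<sigma> (int p)) \<nu> = crd (t (one_row p)) \<nu>"
    using \<nu> assms by (simp add: s_one_row crd_t one_row_in_P)
qed

lemma pos_h_mult:
  assumes "set ps \<subseteq> {..k}" and "pos x"
  shows "pos (h ps * x)"
  using assms
proof (induction ps arbitrary: x)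
  case (Cons p ps)
  then have "pos (t (one_row p) * x)"
    by (intro pos_mult_t one_row_in_P) auto
  then have "pos (\<sigma> (int p) * x)"
    using pos_cong[OF cong_mult_right[OF cong_\<sigma>_t[of p]]] Cons.prems by simp
  with Cons show ?case
    by (simp add: h_Cons)
qed simp

lemma pos_h:
  assumes "set ps \<subseteq> {..k}"
  shows "pos (h ps)"
proof -
  have "pos 1"
    using pos_cong[OF cong_\<sigma>_t[of 0]] pos_t[OF one_row_in_P[of 0]] by (simp add: \<sigma>_0)
  from pos_h_mult[OF assms this] show ?thesis
    by simp
qed

text \<open>Products of at most \<open>m\<close> special classes are sums of the \<open>s b\<close>, without quantum corrections.\<close>

lemma functional_h_nonpos:
  fixes F :: "'r \<Rightarrow> rat"
  assumes F_sum: "\<And>(f :: (nat \<Rightarrow> nat) \<Rightarrow> 'r) A. F (sum f A) = (\<Sum>i\<in>A. F (f i))"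
    and F_cong: "\<And>x y. cong x y \<Longrightarrow> F x = F y"
    and F_s: "\<And>b. b \<in> P \<Longrightarrow> F (s b) \<le> 0"
    and "length ps \<le> m" and "set ps \<subseteq> {..k}" and "b \<in> P" and "\<And>i. i \<ge> m - length ps \<Longrightarrow> b i = 0"
  shows "F (h ps * s b) \<le> 0"
  using assms(4-)
proof (induction ps arbitrary: b)
  case (Cons p ps)
  \<comment> \<open>Each factor lengthens \<open>b\<close> by at most one row, so before each
    multiplication there are at most \<open>m - 1\<close> rows, as \<open>pieri_short\<close>
    demands.\<close>
  have "m - 1 \<ge> m - length (p # ps)"
    by auto
  then have "b (m - 1) = 0"
    by (rule Cons.prems)
  then have "cong (\<sigma> (int p) * s b) (\<Sum>c\<in>strips b p. s c)"
    using Cons.prems by (intro pieri_short) auto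
  then have "F (h (p # ps) * s b) = F (\<Sum>c\<in>strips b p. h ps * s c)"
    unfolding h_Cons sum_distrib_left[symmetric] by (intro F_cong cong_mult_left)
  also have "\<dots> = (\<Sum>c\<in>strips b p. F (h ps * s c))"
    by (rule F_sum)
  also have "\<dots> \<le> 0"
  proof (rule sum_nonpos)
    fix c assume c: "c \<in> strips b p"
    show "F (h ps * s c) \<le> 0"
    proof (rule Cons.IH)
      show "c \<in> P"
        using c strips_subset Cons.prems by auto
      show "c i = 0" if "i \<ge> m - length ps" for i
      proof (cases i)
        case 0
        with that Cons.prems show ?thesis
          by auto
      next
        case (Suc j)
        have "b j = 0"
          using that Suc by (intro Cons.prems) auto
        with Suc c show ?thesis
          by (cases "j < m - 1") (auto simp: strips_def hstrips_def)
      qed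
    qed (use Cons.prems in auto)
  qed
  finally show ?case .
qed (simp add: F_s)

theorem crd_s:
  assumes "\<kappa> \<in> P" and "\<nu> \<in> P"
  shows "crd (s \<kappa>) \<nu> = of_bool (\<kappa> = \<nu>)"
proof (rule ccontr)
  assume neq: "crd (s \<kappa>) \<nu> \<noteq> of_bool (\<kappa> = \<nu>)"
  define nz where "nz d \<longleftrightarrow> d \<ge> 1 \<and> (\<exists>\<kappa>\<in>P. \<exists>\<nu>\<in>P. poly.coeff (crd (s \<kappa>) \<nu>) d \<noteq> 0)" for d
  define d where "d = (LEAST d. nz d)"
  have "\<exists>d. nz d"
  proof -
    obtain d where d: "poly.coeff (crd (s \<kappa>) \<nu>) d \<noteq> poly.coeff (of_bool (\<kappa> = \<nu>)) d"
      using neq by (auto simp: poly_eq_iff)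
    then have "d \<noteq> 0"
      using crd_s_coeff_0[OF assms] by (cases "\<kappa> = \<nu>"; cases "d = 0") auto
    then have "poly.coeff (of_bool (\<kappa> = \<nu>)) d = (0 :: rat)"
      by (cases "\<kappa> = \<nu>"; cases d) auto
    with d \<open>d \<noteq> 0\<close> assms have "nz d"
      unfolding nz_def by auto
    then show ?thesis ..
  qed
  then have "nz d"
    unfolding d_def by (rule LeastI_ex)
  then have d: "d \<ge> 1" "\<exists>\<kappa>\<in>P. \<exists>\<nu>\<in>P. poly.coeff (crd (s \<kappa>) \<nu>) d \<noteq> 0"
    by (auto simp: nz_def)
  have small: "poly.coeff (crd (s \<kappa>) \<nu>) i = of_bool (\<kappa> = \<nu> \<and> i = 0)"
    if "\<kappa> \<in> P" "\<nu> \<in> P" "i < d" for \<kappa> \<nu> i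
  proof (cases "i = 0")
    case False
    have "\<not> nz i"
      using that(3) unfolding d_def by (rule not_less_Least)
    with that False show ?thesis
      by (auto simp: nz_def)
  qed (use that crd_s_coeff_0 in auto)
  \<comment> \<open>Below order \<open>d\<close> in q the transition matrix is the identity, so up
    to order \<open>d\<close> the products with \<open>s \<kappa>\<close> and
    \<open>t \<kappa>\<close> differ only by a first-order term at \<open>d\<close>.\<close>
  have coeff_mult_s: "poly.coeff (crd (s \<kappa> * y) \<nu>) i = poly.coeff (crd (t \<kappa> * y) \<nu>) i +
      (if i < d then 0 else \<Sum>\<mu>\<in>P. poly.coeff (crd (s \<kappa>) \<mu>) d * poly.coeff (crd (t \<mu> * y) \<nu>) 0)"
    if "\<kappa> \<in> P" "\<nu> \<in> P" "i \<le> d" for \<kappa> \<nu> y i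
  proof -
    have "poly.coeff (crd (s \<kappa> * y) \<nu>) i =
        (\<Sum>\<mu>\<in>P. \<Sum>j\<le>i. poly.coeff (crd (s \<kappa>) \<mu>) j * poly.coeff (crd (t \<mu> * y) \<nu>) (i - j))"
      using that by (subst crd_mult_expand) (simp_all add: coeff_sum coeff_mult)
    also have "\<dots> = (\<Sum>\<mu>\<in>P. \<Sum>j\<le>i. (if j = 0 then of_bool (\<kappa> = \<mu>) * poly.coeff (crd (t \<mu> * y) \<nu>) i else 0) +
        (if j = d then poly.coeff (crd (s \<kappa>) \<mu>) d * poly.coeff (crd (t \<mu> * y) \<nu>) 0 else 0))"
      using that d(1) by (intro sum.cong) (auto simp: small)
    also have "\<dots> = (\<Sum>\<mu>\<in>P. of_bool (\<kappa> = \<mu>) * poly.coeff (crd (t \<mu> * y) \<nu>) i) +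
      (if i < d then 0 else \<Sum>\<mu>\<in>P. poly.coeff (crd (s \<kappa>) \<mu>) d * poly.coeff (crd (t \<mu> * y) \<nu>) 0)"
      using that by (auto simp: sum.distrib)
    also have "(\<Sum>\<mu>\<in>P. of_bool (\<kappa> = \<mu>) * poly.coeff (crd (t \<mu> * y) \<nu>) i) = poly.coeff (crd (t \<kappa> * y) \<nu>) i"
      using that by (simp add: of_bool_def if_distrib[where f = "\<lambda>c. c * _"] finite_box_funs cong: if_cong)
    finally show ?thesis .
  qed
  have h_coeff: "poly.coeff (crd (h ps) \<nu>) d = 0"
    if ps: "length ps = m" "set ps \<subseteq> {..k}" and \<nu>: "\<nu> \<in> P" for ps \<nu>
  proof -
    obtain qs where qs: "length qs = m" "set qs \<subseteq> {..k}" "poly.coeff (crd (h qs * s \<nu>) pt) 0 > 0"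
      using exists_h_s_pt_pos[of m \<nu>] \<nu> by auto
    define I where "I \<mu> = poly.coeff (crd (h qs * s \<mu>) pt) 0" for \<mu>
    have I_nonneg: "I \<mu> \<ge> 0" if "\<mu> \<in> P" for \<mu>
      using crd_h_s_pt[OF _ qs(2) that] qs(1) by (force simp: I_def)
    \<comment> \<open>\<open>F\<close> pairs the q^d part of \<open>x\<close> with the intersection
      numbers \<open>I\<close>. On \<open>s b\<close> its sign comes from the positivity of
      \<open>t b * h qs\<close>, while on \<open>h ps\<close> it is a sum of non-negative
      terms.\<close>
    define F where "F x = (\<Sum>\<mu>\<in>P. poly.coeff (crd x \<mu>) d * I \<mu>)" for x
    have F_s: "F (s b) \<le> 0" if b: "b \<in> P" for b
    proof -
      have "poly.coeff (crd (s b * h qs) pt) d = 0"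
        using crd_h_s_pt[OF _ qs(2) b] qs(1) d(1) by (cases d) (auto simp: mult.commute)
      \<comment> \<open>In order 0 of q the products with \<open>t \<mu>\<close> and
        \<open>s \<mu>\<close> agree, so \<open>I\<close> can be computed with either.\<close>
      moreover have "poly.coeff (crd (t \<mu> * h qs) pt) 0 = I \<mu>" if "\<mu> \<in> P" for \<mu>
        using coeff_mult_s[OF that pt_in_P, of 0 "h qs"] d(1) by (simp add: I_def mult.commute)
      ultimately have "F (s b) = - poly.coeff (crd (t b * h qs) pt) d"
        using coeff_mult_s[OF b pt_in_P, of d "h qs"] by (simp add: F_def)
      moreover have "pos (t b * h qs)"
        using pos_mult_t[OF pos_h[OF qs(2)] b] .
      ultimately show ?thesis
        using pt_in_P by (simp add: pos_def)
    qed
    have "F (h ps * s (one_row 0)) \<le> 0"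
    proof (rule functional_h_nonpos)
      show "F (sum f A) = (\<Sum>i\<in>A. F (f i))" for f :: "(nat \<Rightarrow> nat) \<Rightarrow> 'r" and A
        unfolding F_def crd_sum coeff_sum sum_distrib_right by (rule sum.swap)
      show "F x = F y" if "cong x y" for x y
        using that by (simp add: F_def cong_def)
      show "one_row 0 i = 0" for i
        by (simp add: one_row_def)
    qed (use ps F_s one_row_in_P in auto)
    then have "F (h ps) \<le> 0"
      by (simp add: s_one_row \<sigma>_0)
    moreover have nonneg: "poly.coeff (crd (h ps) \<mu>) d * I \<mu> \<ge> 0" if "\<mu> \<in> P" for \<mu>
      using pos_h[OF ps(2)] I_nonneg that by (auto simp: pos_def)
    then have "F (h ps) \<ge> 0"
      unfolding F_def by (rule sum_nonneg)
    ultimately have "F (h ps) = 0"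
      by simp
    then have "poly.coeff (crd (h ps) \<nu>) d * I \<nu> = 0"
      using \<nu> nonneg unfolding F_def by (simp add: sum_nonneg_eq_0_iff finite_box_funs)
    then show ?thesis
      using qs(3) by (simp add: I_def)
  qed
  have "poly.coeff (crd (s \<kappa>) \<nu>) d = 0" if \<kappa>: "\<kappa> \<in> P" and \<nu>: "\<nu> \<in> P" for \<kappa> \<nu>
  proof -
    have prod_0: "poly.coeff (crd (\<Prod>i = 0..<m. \<sigma> (int (\<kappa> i) + int (\<pi> i) - int i)) \<nu>) d = 0"
      if \<pi>: "\<pi> permutes {0..<m}" for \<pi>
    proof -
      define x where "x i = int (\<kappa> i) + int (\<pi> i) - int i" for i
      have x_less: "x i < int n" if "i < m" for i
        using permutes_in_image[OF \<pi>, of i] that box_funs_le[OF \<kappa>, of i] by (simp add: x_def n_eq)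
      show ?thesis
      \<comment> \<open>As all indices are below \<open>n\<close>, either every factor is a special
        class or some factor is congruent to 0.\<close>
      proof (cases "\<forall>i<m. 0 \<le> x i \<and> x i \<le> int k")
        case True
        have "(\<Prod>i = 0..<m. \<sigma> (x i)) = h (map (\<lambda>i. nat (x i)) [0..<m])"
          using True prod.distinct_set_conv_list[of "[0..<m]" "\<lambda>i. \<sigma> (x i)"]
          by (auto simp: h_def intro!: arg_cong[where f = prod_list])
        moreover have "set (map (\<lambda>i. nat (x i)) [0..<m]) \<subseteq> {..k}"
          using True by auto
        ultimately show ?thesis
          using h_coeff[of "map (\<lambda>i. nat (x i)) [0..<m]" \<nu>] \<nu> by (simp add: x_def)
      next
        case False
        then obtain i where i: "i < m" "x i < 0 \<or> x i > int k"
          by force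
        have "cong (\<sigma> (x i)) 0"
          using i x_less[of i] cong_\<sigma>_small by (auto simp: \<sigma>_neg)
        then have "cong (\<sigma> (x i) * (\<Prod>i\<in>{0..<m} - {i}. \<sigma> (x i))) 0"
          using cong_mult_right[of "\<sigma> (x i)" 0] by simp
        also have "\<sigma> (x i) * (\<Prod>i\<in>{0..<m} - {i}. \<sigma> (x i)) = (\<Prod>i = 0..<m. \<sigma> (x i))"
          using i by (subst prod.remove[of _ i]) auto
        finally show ?thesis
          using \<nu> by (simp add: cong_def x_def)
      qed
    qed
    have "poly.coeff (crd (of_int (sign \<pi>) * y) \<nu>) d = 0" if "poly.coeff (crd y \<nu>) d = 0" for \<pi> :: "nat \<Rightarrow> nat" and y
      using that by (cases \<pi> rule: sign_cases) (auto simp: crd_uminus)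
    then show ?thesis
      by (auto simp: jt_det_expand crd_sum coeff_sum prod_0 intro!: sum.neutral)
  qed
  with d(2) show False
    by blast
qed

end

lemma (in comm_ring_hom) jt_det_hom: "jt_det (\<lambda>x. hom (H x)) N a = hom (jt_det H N a)"
  by (simp add: jt_det_def flip: hom_det) (intro arg_cong[where f = det] eq_matI; simp)

section \<open>The classes $\sigma_p$\<close>

text \<open>Adding multiples of the other columns, with the earlier determinants \<open>S\<close> as
  coefficients, clears the last column below its top entry by the relation for smaller
  \<open>x\<close>. The complementary minor is unitriangular, so the top entry is the determinant up
  to sign.\<close>

lemma jt_det_const_recursion:
  fixes c :: "int \<Rightarrow> 'a :: comm_ring_1"
  assumes c0: "c 0 = 1" and cneg: "\<And>x. x < 0 \<Longrightarrow> c x = 0" and "x \<ge> 1"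
  shows "(\<Sum>l\<le>x. c (int l) * ((-1) ^ (x - l) * jt_det c (x - l) (\<lambda>_. 1))) = 0"
  using \<open>x \<ge> 1\<close>
proof (induction x rule: less_induct)
  case (less x)
  then obtain q where x: "x = Suc q"
    by (cases x) auto
  define S where "S i = jt_det c i (\<lambda>_. 1)" for i
  define C where "C = mat (Suc q) (Suc q) (\<lambda>(i, j). c (1 + int j - int i))"
  define U where "U = mat (Suc q) (Suc q)
    (\<lambda>(i, j). if j = q then (-1) ^ (q - i) * S (q - i) else if i = j then 1 else 0)"
  have C: "C \<in> carrier_mat (Suc q) (Suc q)" and U: "U \<in> carrier_mat (Suc q) (Suc q)"
    by (auto simp: C_def U_def)
  have S0: "S 0 = 1"
    by (simp add: S_def jt_det_def)
  have last: "(C * U) $$ (i, q) = (\<Sum>j\<le>q. c (1 + int j - int i) * ((-1) ^ (q - j) * S (q - j)))"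
    if "i \<le> q" for i
    using that by (auto simp: C_def U_def scalar_prod_def atLeast0LessThan lessThan_Suc_atMost
          simp del: sum.lessThan_Suc sum.atMost_Suc intro!: sum.cong)
  have front: "(C * U) $$ (i, j) = c (1 + int j - int i)" if "i \<le> q" "j < q" for i j
    using that by (simp add: C_def U_def scalar_prod_def if_distrib[where f = "\<lambda>c. _ * c"] cong: if_cong)
  have zero: "(C * U) $$ (i, q) = 0" if i: "i \<ge> 1" "i \<le> q" for i
  proof -
    have "(C * U) $$ (i, q) = (\<Sum>j\<in>{i - 1..q}. c (1 + int j - int i) * ((-1) ^ (q - j) * S (q - j)))"
      unfolding last[OF i(2)] by (rule sum.mono_neutral_right) (auto simp: cneg)
    also have "\<dots> = (\<Sum>l\<le>q + 1 - i. c (int l) * ((-1) ^ (q + 1 - i - l) * S (q + 1 - i - l)))"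
      by (rule sum.reindex_bij_witness[where i = "\<lambda>l. l + i - 1" and j = "\<lambda>j. j + 1 - i"])
         (use i in \<open>auto simp: of_nat_diff algebra_simps\<close>)
    also have "\<dots> = 0"
      using less.IH[of "q + 1 - i"] i by (simp add: x S_def)
    finally show ?thesis .
  qed
  define Y where "Y = (\<Sum>j\<le>q. c (1 + int j) * ((-1) ^ (q - j) * S (q - j)))"
  have "S (Suc q) = det C"
    by (simp add: S_def jt_det_def C_def)
  also have "\<dots> = det (C * U)"
    using det_unitriangular_upper[OF U] det_mult[OF C U] by (simp add: U_def S0)
  also have "\<dots> = (\<Sum>i<Suc q. (C * U) $$ (i, q) * cofactor (C * U) i q)"
    by (rule laplace_expansion_column[OF mult_carrier_mat[OF C U]]) simp
  also have "\<dots> = (C * U) $$ (0, q) * cofactor (C * U) 0 q"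
    using zero by (simp add: sum.lessThan_Suc_shift del: sum.lessThan_Suc index_mult_mat)
  also have "cofactor (C * U) 0 q = (-1) ^ q * det (mat_delete (C * U) 0 q)"
    by (simp add: cofactor_def)
  also have "det (mat_delete (C * U) 0 q) = 1"
    by (rule det_unitriangular_upper[of _ q])
       (use C U in \<open>auto simp: mat_delete_def front c0 cneg simp del: index_mult_mat(1)\<close>)
  also have "(C * U) $$ (0, q) = Y"
    by (simp add: last Y_def del: index_mult_mat)
  finally have "(-1) ^ Suc q * S (Suc q) = - Y"
    by (simp add: mult.left_commute flip: power_add mult_2)
  moreover have "(\<Sum>l\<le>Suc q. c (int l) * ((-1) ^ (Suc q - l) * S (Suc q - l))) = (-1) ^ Suc q * S (Suc q) + Y"
    unfolding Y_def by (subst sum.atMost_Suc_shift) (simp add: c0 add_ac)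
  ultimately show ?case
    by (simp add: x S_def)
qed

lemma sigma_eq_jt_det: "sigma m p = (if p < 0 then 0 else jt_det (c_gen m) (nat p) (\<lambda>_. 1))"
  by (simp add: sigma_def jt_det_def)

lemma sigma_recursion:
  assumes "x \<ge> 1"
  shows "(\<Sum>i\<le>m. (-1) ^ i * c_gen m (int i) * sigma m (x - int i)) = 0"
proof -
  define y where "y = nat x"
  have x: "x = int y" "y \<ge> 1"
    using assms by (auto simp: y_def)
  let ?f = "\<lambda>i. (-1) ^ i * c_gen m (int i) * sigma m (x - int i)"
  \<comment> \<open>The two summation ranges differ only in zero terms: \<open>c_gen\<close>
    vanishes above \<open>m\<close>, and \<open>sigma\<close> at negative indices.\<close>
  have "sum ?f {..m} = sum ?f {..max m y}"
    by (rule sum.mono_neutral_left) (auto simp: c_gen_def)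
  also have "\<dots> = sum ?f {..y}"
    by (rule sum.mono_neutral_right) (auto simp: sigma_def x)
  also have "\<dots> = (\<Sum>l\<le>y. (-1) ^ y * (c_gen m (int l) * ((-1) ^ (y - l) * jt_det (c_gen m) (y - l) (\<lambda>_. 1))))"
  proof (rule sum.cong[OF refl])
    fix l assume "l \<in> {..y}"
    then have l: "l \<le> y"
      by simp
    have "(-1) ^ y = ((-1) ^ l * (-1) ^ (y - l) :: cpoly)"
      using l by (simp flip: power_add)
    then have sign: "(-1) ^ l = ((-1) ^ y * (-1) ^ (y - l) :: cpoly)"
      by (simp add: mult.assoc flip: power_mult_distrib)
    have "x - int l = int (y - l)"
      using l by (simp add: x)
    then have "sigma m (x - int l) = jt_det (c_gen m) (y - l) (\<lambda>_. 1)"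
      by (simp add: sigma_eq_jt_det)
    then show "(-1) ^ l * c_gen m (int l) * sigma m (x - int l) =
        (-1) ^ y * (c_gen m (int l) * ((-1) ^ (y - l) * jt_det (c_gen m) (y - l) (\<lambda>_. 1)))"
      unfolding sign by (simp only: mult_ac)
  qed
  also have "\<dots> = 0"
    unfolding sum_distrib_left[symmetric]
    using jt_det_const_recursion[of "c_gen m" y] x by (simp add: c_gen_def)
  finally show ?thesis .
qed

lemma sigma_neg: "x < 0 \<Longrightarrow> sigma m x = 0"
  by (simp add: sigma_def)

lemma sigma_0: "sigma m 0 = 1"
  by (simp add: sigma_def)

section \<open>Rescaling the indeterminates\<close>

definition monomial_weight :: "(nat \<Rightarrow> rat) \<Rightarrow> (nat \<Rightarrow>\<^sub>0 nat) \<Rightarrow> rat" where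
  "monomial_weight w t = (\<Prod>i\<in>Poly_Mapping.keys t. w i ^ Poly_Mapping.lookup t i)"

text \<open>The substitution that multiplies the \<open>i\<close>-th indeterminate by
  \<open>w i\<close>. It serves twice: weights 0 and 1 project onto S, and weights
  \<open>2 ^ i\<close> detect degrees.\<close>

definition rescale :: "(nat \<Rightarrow> rat) \<Rightarrow> cpoly \<Rightarrow> cpoly" where
  "rescale w p = Poly_Mapping.mapp (\<lambda>t a. monomial_weight w t * a) p"

lemma monomial_weight_superset:
  assumes "finite A" "Poly_Mapping.keys t \<subseteq> A"
  shows "monomial_weight w t = (\<Prod>i\<in>A. w i ^ Poly_Mapping.lookup t i)"
  unfolding monomial_weight_def by (rule prod.mono_neutral_left) (use assms in \<open>auto simp: in_keys_iff\<close>)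

lemma monomial_weight_0 [simp]: "monomial_weight w 0 = 1"
  by (simp add: monomial_weight_def)

lemma monomial_weight_add: "monomial_weight w (t + u) = monomial_weight w t * monomial_weight w u"
proof -
  let ?A = "Poly_Mapping.keys t \<union> Poly_Mapping.keys u"
  have "monomial_weight w v = (\<Prod>i\<in>?A. w i ^ Poly_Mapping.lookup v i)" if "v \<in> {t, u, t + u}" for v
    using that Poly_Mapping.keys_add[of t u] by (intro monomial_weight_superset) auto
  then show ?thesis
    by (simp add: lookup_add power_add prod.distrib)
qed

lemma lookup_rescale: "Poly_Mapping.lookup (rescale w p) t = monomial_weight w t * Poly_Mapping.lookup p t"
  by (auto simp: rescale_def lookup_mapp in_keys_iff when_def)

lemma rescale_single: "rescale w (Poly_Mapping.single t a) = Poly_Mapping.single t (monomial_weight w t * a)"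
  by (rule poly_mapping_eqI) (auto simp: lookup_rescale lookup_single when_def)

lemma rescale_add: "rescale w (p + q) = rescale w p + rescale w q"
  by (rule poly_mapping_eqI) (auto simp: lookup_rescale lookup_add distrib_left)

lemma rescale_sum: "rescale w (sum f A) = (\<Sum>i\<in>A. rescale w (f i))"
proof (induction A rule: infinite_finite_induct)
qed (auto simp: rescale_add intro!: poly_mapping_eqI simp: lookup_rescale)

lemma poly_mapping_sum_single:
  "p = (\<Sum>t\<in>Poly_Mapping.keys p. Poly_Mapping.single t (Poly_Mapping.lookup p t))"
  by (rule poly_mapping_eqI)
     (auto simp: lookup_sum lookup_single when_def in_keys_iff cong: if_cong)

lemma rescale_mult: "rescale w (p * q) = rescale w p * rescale w q"
proof -
  let ?s = "\<lambda>p t. Poly_Mapping.single t (Poly_Mapping.lookup p t)"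
  have "rescale w (sum (?s p) A * sum (?s q) B) = rescale w (sum (?s p) A) * rescale w (sum (?s q) B)" for A B
    by (simp add: sum_product rescale_sum mult_single rescale_single monomial_weight_add mult_ac)
  from this[of "Poly_Mapping.keys p" "Poly_Mapping.keys q"] show ?thesis
    by (simp flip: poly_mapping_sum_single)
qed

lemma comm_ring_hom_rescale: "comm_ring_hom (rescale w)"
proof
  show "rescale w 1 = 1"
    using rescale_single[of w 0 1] by simp
qed (auto simp: rescale_add rescale_mult intro: poly_mapping_eqI simp: lookup_rescale)

lemma rescale_const: "rescale w (const_c a) = const_c a"
  by (simp add: const_c_def rescale_single)

lemma comm_ring_hom_const_c: "comm_ring_hom const_c"
  by standard (auto simp: const_c_def single_add mult_single)

lemma const_c_mult_lookup: "Poly_Mapping.lookup (const_c a * p) t = a * Poly_Mapping.lookup p t"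
proof -
  have "const_c a * p = (\<Sum>t\<in>Poly_Mapping.keys p. Poly_Mapping.single t (a * Poly_Mapping.lookup p t))"
    by (subst poly_mapping_sum_single[of p]) (simp add: sum_distrib_left const_c_def mult_single)
  then show ?thesis
    by (simp add: lookup_sum lookup_single when_def in_keys_iff cong: if_cong)
qed

subsection \<open>The retraction onto $S$\<close>

text \<open>S becomes the fixed set of a ring homomorphism, so its closure properties are
  homomorphism laws, and functions on S extend to the whole type.\<close>

definition retract :: "nat \<Rightarrow> cpoly \<Rightarrow> cpoly" where
  "retract m = rescale (\<lambda>i. of_bool (i \<in> {1..m}))"

lemma monomial_weight_of_bool:
  "monomial_weight (\<lambda>i. of_bool (i \<in> A)) t = of_bool (Poly_Mapping.keys t \<subseteq> A)"
  by (auto simp: monomial_weight_def in_keys_iff intro!: prod.neutral prod_zero bexI)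

lemma lookup_retract:
  "Poly_Mapping.lookup (retract m p) t = (if Poly_Mapping.keys t \<subseteq> {1..m} then Poly_Mapping.lookup p t else 0)"
  unfolding retract_def lookup_rescale monomial_weight_of_bool by simp

lemma S_carrier_iff_retract: "p \<in> S_carrier m \<longleftrightarrow> retract m p = p"
  unfolding S_carrier_def poly_mapping_eq_iff fun_eq_iff lookup_retract by (auto simp: in_keys_iff)

lemma retract_retract: "retract m (retract m p) = retract m p"
  by (rule poly_mapping_eqI) (simp add: lookup_retract)

interpretation retract: comm_ring_hom "retract m" for m
  unfolding retract_def by (rule comm_ring_hom_rescale)

interpretation retract_poly: map_poly_comm_ring_hom "retract m" for m ..

abbreviation retract_poly :: "nat \<Rightarrow> cpoly poly \<Rightarrow> cpoly poly" where
  "retract_poly m \<equiv> map_poly (retract m)"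

lemma carrier_Sq_iff: "P \<in> carrier (Sq m) \<longleftrightarrow> retract_poly m P = P"
  by (simp add: Sq_def S_carrier_iff_retract poly_eq_iff)

lemma retract_poly_in_carrier: "retract_poly m P \<in> carrier (Sq m)"
  by (simp add: carrier_Sq_iff poly_eq_iff retract_retract)

lemma carrier_Sq_closed:
  "0 \<in> carrier (Sq m)" "1 \<in> carrier (Sq m)"
  "P \<in> carrier (Sq m) \<Longrightarrow> - P \<in> carrier (Sq m)"
  "P \<in> carrier (Sq m) \<Longrightarrow> Q \<in> carrier (Sq m) \<Longrightarrow> P + Q \<in> carrier (Sq m)"
  "P \<in> carrier (Sq m) \<Longrightarrow> Q \<in> carrier (Sq m) \<Longrightarrow> P - Q \<in> carrier (Sq m)"
  "P \<in> carrier (Sq m) \<Longrightarrow> Q \<in> carrier (Sq m) \<Longrightarrow> P * Q \<in> carrier (Sq m)"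
  by (auto simp: carrier_Sq_iff retract_poly.hom_uminus retract_poly.hom_add retract_poly.hom_minus
      retract_poly.hom_mult)

lemma carrier_Sq_sum: "(\<And>i. i \<in> A \<Longrightarrow> f i \<in> carrier (Sq m)) \<Longrightarrow> sum f A \<in> carrier (Sq m)"
  by (induction A rule: infinite_finite_induct) (auto intro: carrier_Sq_closed)

lemma retract_c_gen: "retract m (c_gen m x) = c_gen m x"
proof -
  have "c_gen m x \<in> S_carrier m"
    by (auto simp: c_gen_def S_carrier_def)
  then show ?thesis
    by (simp add: S_carrier_iff_retract)
qed

lemma retract_sigma: "retract m (sigma m x) = sigma m x"
  by (simp add: sigma_eq_jt_det retract_c_gen flip: retract.jt_det_hom)

lemma retract_const_c: "retract m (const_c a) = const_c a"
  by (simp add: retract_def rescale_const)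

interpretation const_c: comm_ring_hom const_c
  by (rule comm_ring_hom_const_c)

interpretation const_c_poly: map_poly_comm_ring_hom const_c ..

abbreviation emb :: "rat poly \<Rightarrow> cpoly poly" where
  "emb \<equiv> map_poly const_c"

lemma monom_eq_emb: "Polynomial.monom ((-1) ^ m * const_c \<alpha>) 1 = emb [:0, (-1) ^ m * \<alpha>:]"
  by (auto simp: poly_eq_iff coeff_pCons const_c.hom_mult const_c.hom_power const_c.hom_uminus
      split: nat.split)

lemma retract_emb: "retract_poly m (emb f) = emb f"
  by (simp add: poly_eq_iff retract_const_c)

lemma emb_in_carrier: "emb f \<in> carrier (Sq m)"
  by (simp add: carrier_Sq_iff retract_emb)

lemma emb_const: "emb [:a:] = [:const_c a:]"
  by (simp add: poly_eq_iff coeff_pCons split: nat.split)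

interpretation const_poly: comm_ring_hom "\<lambda>a :: 'a :: comm_ring_1. [:a:]"
  by standard (auto simp: one_pCons)

lemma const_sigma_in_carrier: "[:sigma m x:] \<in> carrier (Sq m)"
  by (simp add: carrier_Sq_iff poly_eq_iff coeff_pCons retract_sigma split: nat.split)

subsection \<open>The scaling automorphism\<close>

text \<open>Homogeneous elements of degree \<open>d\<close> are the eigenvectors with eigenvalue $2^d$ of the
  automorphism $c_i \mapsto 2^i c_i$, $q \mapsto 2^n q$.\<close>

definition scale2 :: "cpoly \<Rightarrow> cpoly" where
  "scale2 = rescale (\<lambda>i. 2 ^ i)"

interpretation scale2: comm_ring_hom scale2
  unfolding scale2_def by (rule comm_ring_hom_rescale)

interpretation scale2_poly: map_poly_comm_ring_hom scale2 ..

definition Scale2 :: "nat \<Rightarrow> cpoly poly \<Rightarrow> cpoly poly" where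
  "Scale2 n P = map_poly scale2 P \<circ>\<^sub>p [:0, const_c (2 ^ n):]"

lemma coeff_Scale2: "poly.coeff (Scale2 n P) i = const_c (2 ^ (n * i)) * scale2 (poly.coeff P i)"
  by (simp add: Scale2_def coeff_pcompose_linear power_mult flip: const_c.hom_power)

interpretation Scale2: comm_ring_hom "Scale2 n" for n
  by standard (auto simp: Scale2_def pcompose_add pcompose_mult scale2_poly.hom_add scale2_poly.hom_mult)

lemma scale2_c_gen: "scale2 (c_gen m x) = const_c (2 powi x) * c_gen m x"
proof -
  have "monomial_weight (\<lambda>i. 2 ^ i) (Poly_Mapping.single (nat x) 1) = 2 powi x" if "x \<ge> 1"
    using that by (simp add: monomial_weight_def power_int_def)
  then show ?thesis
    by (auto simp: c_gen_def scale2_def[symmetric] rescale_single[of "\<lambda>i. 2 ^ i", folded scale2_def] const_c_def mult_single)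
qed

text \<open>For every permutation the shifts \<open>\<pi> i - i\<close> sum to 0, so all terms of
  the determinant have the same weight.\<close>

lemma jt_det_scale:
  "jt_det (\<lambda>x. const_c (2 powi x) * H x) N a = const_c (2 powi (\<Sum>i = 0..<N. a i)) * jt_det H N a"
proof -
  have powi: "(\<Prod>i\<in>A. const_c (2 powi f i)) = const_c (2 powi (\<Sum>i\<in>A. f i))" for A :: "nat set" and f
    by (induction A rule: infinite_finite_induct) (auto simp: power_int_add const_c.hom_mult)
  have "(\<Sum>i = 0..<N. a i + int (\<pi> i) - int i) = (\<Sum>i = 0..<N. a i)" if "\<pi> permutes {0..<N}" for \<pi>
    using sum.permute[OF that, of int] by (simp add: sum.distrib sum_subtractf o_def)
  then show ?thesis
    by (auto simp: jt_det_expand prod.distrib powi sum_distrib_left mult_ac intro!: sum.cong)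
qed

lemma scale2_sigma: "scale2 (sigma m x) = const_c (2 powi x) * sigma m x"
  by (simp add: sigma_eq_jt_det scale2_c_gen jt_det_scale flip: scale2.jt_det_hom)

lemma sigma_part_eq_jt_det: "sigma_part m la = jt_det (sigma m) (length la) (\<lambda>i. int (la ! i))"
  by (simp add: sigma_part_def jt_det_def)

lemma retract_sigma_part: "retract m (sigma_part m la) = sigma_part m la"
  by (simp add: sigma_part_eq_jt_det retract_sigma flip: retract.jt_det_hom)

lemma scale2_sigma_part: "scale2 (sigma_part m la) = const_c (2 ^ sum_list la) * sigma_part m la"
proof -
  have "(\<Sum>i = 0..<length la. int (la ! i)) = int (sum_list la)"
    by (simp add: sum_list_sum_nth)
  then show ?thesis
    by (simp add: sigma_part_eq_jt_det scale2_sigma jt_det_scale flip: scale2.jt_det_hom)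
qed

lemma Scale2_const: "Scale2 n [:p:] = [:scale2 p:]"
  by (simp add: poly_eq_iff coeff_Scale2 coeff_pCons split: nat.split)

lemma Scale2_emb: "Scale2 n (emb f) = emb (f \<circ>\<^sub>p [:0, 2 ^ n:])"
  by (simp add: poly_eq_iff coeff_Scale2 coeff_pcompose_linear scale2_def rescale_const power_mult const_c.hom_mult)

lemma scale2_homogeneous:
  assumes "S_homogeneous d p"
  shows "scale2 p = const_c (2 ^ d) * p"
proof (rule poly_mapping_eqI)
  fix t
  have "monomial_weight (\<lambda>i. 2 ^ i) t = 2 ^ d" if "Poly_Mapping.lookup p t \<noteq> 0"
    using assms that by (auto simp: S_homogeneous_def in_keys_iff monomial_weight_def
        power_sum simp flip: power_mult)
  then show "Poly_Mapping.lookup (scale2 p) t = Poly_Mapping.lookup (const_c (2 ^ d) * p) t"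
    by (auto simp: scale2_def lookup_rescale const_c_mult_lookup)
qed

lemma Scale2_homogeneous:
  assumes "Sq_homogeneous n d P"
  shows "Scale2 n P = emb [:2 ^ d:] * P"
proof (rule poly_eqI)
  fix i
  show "poly.coeff (Scale2 n P) i = poly.coeff (emb [:2 ^ d:] * P) i"
  proof (cases "poly.coeff P i = 0")
    case False
    with assms have le: "n * i \<le> d" and "S_homogeneous (d - n * i) (poly.coeff P i)"
      by (auto simp: Sq_homogeneous_def)
    then have "poly.coeff (Scale2 n P) i = const_c (2 ^ (n * i)) * (const_c (2 ^ (d - n * i)) * poly.coeff P i)"
      by (simp add: coeff_Scale2 scale2_homogeneous)
    also have "\<dots> = const_c (2 ^ (n * i) * 2 ^ (d - n * i)) * poly.coeff P i"
      by (simp only: const_c.hom_mult mult.assoc)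
    also have "2 ^ (n * i) * 2 ^ (d - n * i) = (2 ^ d :: rat)"
      using le by (simp flip: power_add)
    finally show ?thesis
      by (simp add: emb_const)
  qed (simp add: coeff_Scale2 emb_const)
qed

lemma Scale2_in_carrier:
  assumes "P \<in> carrier (Sq m)"
  shows "Scale2 n P \<in> carrier (Sq m)"
proof -
  have "retract m (scale2 p) = scale2 (retract m p)" for p
    by (rule poly_mapping_eqI) (simp add: retract_def scale2_def lookup_rescale)
  with assms show ?thesis
    by (simp add: carrier_Sq_iff poly_eq_iff coeff_Scale2 retract.hom_mult retract_const_c)
qed

subsection \<open>Partitions as functions\<close>

definition pad :: "nat list \<Rightarrow> nat \<Rightarrow> nat" where
  "pad la i = (if i < length la then la ! i else 0)"

definition unpad :: "(nat \<Rightarrow> nat) \<Rightarrow> nat list" where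
  "unpad a = map a [0..<(LEAST i. a i = 0)]"

lemma pad_in_box_funs:
  assumes "la \<in> box_partitions m k"
  shows "pad la \<in> box_funs m k"
proof -
  have la: "sorted_wrt (\<ge>) la" "length la \<le> m" "la \<noteq> [] \<longrightarrow> hd la \<le> k"
    using assms by (auto simp: box_partitions_def is_partition_def)
  have "la ! Suc i \<le> la ! i" if "Suc i < length la" for i
    using sorted_wrt_nth_less[OF la(1), of i "Suc i"] that by simp
  with la show ?thesis
    by (auto simp: box_funs_def pad_def hd_conv_nth)
qed

lemma unpad_pad:
  assumes "la \<in> box_partitions m k"
  shows "unpad (pad la) = la"
proof -
  have "0 \<notin> set la"
    using assms by (auto simp: box_partitions_def is_partition_def)
  then have "la ! i \<noteq> 0" if "i < length la" for i
    using that by (auto simp: in_set_conv_nth)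
  then have nz: "pad la i \<noteq> 0" if "i < length la" for i
    using that by (simp add: pad_def)
  have "(LEAST i. pad la i = 0) = length la"
  proof (rule Least_equality)
    show "length la \<le> i" if "pad la i = 0" for i
      using nz[of i] that by (cases "i < length la") auto
  qed (simp add: pad_def)
  then show ?thesis
    by (auto simp: unpad_def pad_def intro: nth_equalityI)
qed

lemma
  assumes a: "a \<in> box_funs m k"
  shows unpad_in_box_partitions: "unpad a \<in> box_partitions m k"
    and pad_unpad: "pad (unpad a) = a"
proof -
  define L where "L = (LEAST i. a i = 0)"
  have am: "a m = 0"
    using a by (simp add: box_funs_def)
  then have aL: "a L = 0" and "L \<le> m"
    unfolding L_def by (rule LeastI, rule Least_le)
  have nz: "a i \<noteq> 0" if "i < L" for i
    using that unfolding L_def by (rule not_less_Least)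
  have anti: "a j \<le> a i" if "i \<le> j" for i j
    using box_funs_antimono[OF a that] .
  have "sorted_wrt (\<ge>) (map a [0..<L])"
    by (auto simp: sorted_wrt_iff_nth_less intro: anti)
  with nz \<open>L \<le> m\<close> box_funs_le[OF a] show "unpad a \<in> box_partitions m k"
    by (force simp: box_partitions_def is_partition_def unpad_def hd_map simp flip: L_def)
  show "pad (unpad a) = a"
  proof
    fix i
    show "pad (unpad a) i = a i"
      using anti[of L i] aL by (auto simp: pad_def unpad_def simp flip: L_def)
  qed
qed

lemma jt_det_zero_rows:
  assumes "H 0 = 1" and "\<And>x. x < 0 \<Longrightarrow> H x = 0" and "N \<le> M" and "\<And>i. N \<le> i \<Longrightarrow> i < M \<Longrightarrow> a i = 0"
  shows "jt_det H M a = jt_det H N a"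
  using assms(3,4)
proof (induction M rule: dec_induct)
  case (step M)
  then show ?case
    using jt_det_last_row_zero[of H a M] assms(1,2) by simp
qed simp

lemma sigma_part_pad:
  assumes "la \<in> box_partitions m k"
  shows "jt_det (\<lambda>x. [:sigma m x:]) m (\<lambda>i. int (pad la i)) = [:sigma_part m la:]"
proof -
  have "jt_det (sigma m) m (\<lambda>i. int (pad la i)) = jt_det (sigma m) (length la) (\<lambda>i. int (pad la i))"
    using assms by (intro jt_det_zero_rows) (auto simp: sigma_0 sigma_neg box_partitions_def pad_def)
  also have "\<dots> = sigma_part m la"
    unfolding sigma_part_eq_jt_det by (rule jt_det_cong) (simp add: pad_def)
  finally show ?thesis
    using const_poly.jt_det_hom[of "sigma m" m] by simp
qed

lemma sum_pad:
  assumes "la \<in> box_partitions m k"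
  shows "(\<Sum>i<m. pad la i) = sum_list la"
proof -
  have "(\<Sum>i<m. pad la i) = (\<Sum>i<length la. pad la i)"
    using assms by (intro sum.mono_neutral_right) (auto simp: box_partitions_def pad_def)
  also have "\<dots> = sum_list la"
    by (simp add: sum_list_sum_nth pad_def atLeast0LessThan)
  finally show ?thesis .
qed

section \<open>The theorem in terms of representatives\<close>

text \<open>The hypotheses on the quotient, restated for representatives in S[q] and membership in
  the ideal. The grading enters through \<open>Scale2\<close>, by the eigenvector equations for the
  \<open>t la\<close> and the invariance of \<open>I\<close>.\<close>

locale qh_representatives =
  fixes m n k :: nat and \<alpha> :: rat and I :: "cpoly poly set"
    and t :: "nat list \<Rightarrow> cpoly poly"
  assumes m_pos: "1 \<le> m" and m_less: "m < n" and k_eq: "k = n - m"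
    and I_carrier: "I \<subseteq> carrier (Sq m)"
    and I_0: "0 \<in> I"
    and I_add: "x \<in> I \<Longrightarrow> y \<in> I \<Longrightarrow> x + y \<in> I"
    and I_mult: "x \<in> I \<Longrightarrow> y \<in> carrier (Sq m) \<Longrightarrow> y * x \<in> I"
    and I_Scale2: "x \<in> I \<Longrightarrow> Scale2 n x \<in> I"
    and I_sigma: "n - m + 1 \<le> p \<Longrightarrow> p \<le> n - 1 \<Longrightarrow> [:sigma m (int p):] \<in> I"
    and I_sigma_n: "[:sigma m (int n):] + Polynomial.monom ((-1) ^ m * const_c \<alpha>) 1 \<in> I"
    and t_carrier: "la \<in> box_partitions m k \<Longrightarrow> t la \<in> carrier (Sq m)"
    and t_Scale2: "la \<in> box_partitions m k \<Longrightarrow> Scale2 n (t la) = emb [:2 ^ sum_list la:] * t la"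
    and generate: "x \<in> carrier (Sq m) \<Longrightarrow> \<exists>f. x - (\<Sum>la\<in>box_partitions m k. emb (f la) * t la) \<in> I"
    and independent: "(\<Sum>la\<in>box_partitions m k. emb (f la) * t la) \<in> I \<Longrightarrow> la \<in> box_partitions m k \<Longrightarrow> f la = 0"
    and t_sigma: "la \<in> box_partitions m k \<Longrightarrow>
      \<exists>w\<in>carrier (Sq m). t la - [:sigma_part m la:] - emb [:0, 1:] * w \<in> I"
    and t_mult: "la \<in> box_partitions m k \<Longrightarrow> mu \<in> box_partitions m k \<Longrightarrow>
      \<exists>g. (\<forall>nu i. poly.coeff (g nu) i \<ge> 0) \<and> t la * t mu - (\<Sum>nu\<in>box_partitions m k. emb (g nu) * t nu) \<in> I"
begin

abbreviation B :: "nat list set" where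
  "B \<equiv> box_partitions m k"

section \<open>Coordinates modulo the ideal and their degrees\<close>

lemma I_uminus: "x \<in> I \<Longrightarrow> - x \<in> I"
  using I_mult[of x "- 1"] carrier_Sq_closed(3)[OF carrier_Sq_closed(2)] by simp

lemma I_diff: "x \<in> I \<Longrightarrow> y \<in> I \<Longrightarrow> x - y \<in> I"
  using I_add[of x "- y"] I_uminus[of y] by simp

text \<open>\<open>positive_deformation\<close> asks for coordinates on a whole type, whereas only
  elements of S[q] have classes. Retracting first extends them, compatibly with products because the
  retraction is a ring homomorphism. The value 0 outside \<open>B\<close> makes additivity
  unconditional.\<close>

definition coords :: "cpoly poly \<Rightarrow> nat list \<Rightarrow> rat poly" where
  "coords x la = (if la \<in> B
    then (SOME f. retract_poly m x - (\<Sum>la\<in>B. emb (f la) * t la) \<in> I) la else 0)"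

lemma coords_eqI:
  assumes "retract_poly m x - (\<Sum>la\<in>B. emb (f la) * t la) \<in> I" and "la \<in> B"
  shows "coords x la = f la"
proof -
  define g where "g = (SOME f. retract_poly m x - (\<Sum>la\<in>B. emb (f la) * t la) \<in> I)"
  have "retract_poly m x - (\<Sum>la\<in>B. emb (g la) * t la) \<in> I"
    unfolding g_def by (rule someI[of _ f]) (rule assms(1))
  from I_diff[OF assms(1) this] have "(\<Sum>la\<in>B. emb (g la - f la) * t la) \<in> I"
    by (simp add: const_c_poly.hom_minus left_diff_distrib sum_subtractf)
  from independent[OF this assms(2)] show ?thesis
    using assms(2) by (simp add: coords_def g_def)
qed

lemma coords_spec: "retract_poly m x - (\<Sum>la\<in>B. emb (coords x la) * t la) \<in> I"
proof -
  obtain f where f: "retract_poly m x - (\<Sum>la\<in>B. emb (f la) * t la) \<in> I"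
    using generate[OF retract_poly_in_carrier] by blast
  have "(\<Sum>la\<in>B. emb (coords x la) * t la) = (\<Sum>la\<in>B. emb (f la) * t la)"
    using coords_eqI[OF f] by (intro sum.cong) auto
  with f show ?thesis
    by simp
qed

lemma coords_outside: "la \<notin> B \<Longrightarrow> coords x la = 0"
  by (simp add: coords_def)

lemma coords_add: "coords (x + y) la = coords x la + coords y la"
proof (cases "la \<in> B")
  case True
  then show ?thesis
    using I_add[OF coords_spec[of x] coords_spec[of y]]
    by (intro coords_eqI[where f = "\<lambda>la. coords x la + coords y la"])
       (auto simp: retract_poly.hom_add const_c_poly.hom_add distrib_right sum.distrib algebra_simps)
qed (simp add: coords_outside)

lemma coords_emb: "coords (emb g * x) la = g * coords x la"
proof (cases "la \<in> B")
  case True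
  then show ?thesis
    using I_mult[OF coords_spec[of x] emb_in_carrier[of g]]
    by (intro coords_eqI[where f = "\<lambda>la. g * coords x la"])
       (auto simp: retract_poly.hom_mult const_c_poly.hom_mult retract_emb right_diff_distrib
         sum_distrib_left mult.assoc)
qed (simp add: coords_outside)

lemma coords_diff: "coords (x - y) la = coords x la - coords y la"
  using coords_add[of "x - y" y la] by simp

lemma coords_I: "retract_poly m x \<in> I \<Longrightarrow> coords x la = 0"
  by (cases "la \<in> B") (auto simp: coords_outside intro: coords_eqI[where f = "\<lambda>_. 0"])

lemma coords_0_iff: "(\<forall>la\<in>B. coords x la = 0) \<longleftrightarrow> retract_poly m x \<in> I"
  using coords_spec[of x] coords_I[of x] by auto

lemma retract_I: "x \<in> I \<Longrightarrow> retract_poly m x = x"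
  using I_carrier carrier_Sq_iff by blast

lemma coords_mult_I: "x \<in> I \<Longrightarrow> coords (x * y) la = 0"
  using I_mult[OF _ retract_poly_in_carrier, of x y]
  by (intro coords_I) (simp add: retract_poly.hom_mult retract_I mult.commute)

lemma finite_B: "finite B"
proof (rule finite_subset)
  show "B \<subseteq> unpad ` box_funs m k"
    using pad_in_box_funs unpad_pad by (metis image_eqI subsetI)
qed (simp add: finite_box_funs)

lemma coords_t: "la \<in> B \<Longrightarrow> mu \<in> B \<Longrightarrow> coords (t la) mu = of_bool (la = mu)"
proof (rule coords_eqI)
  assume la: "la \<in> B"
  then have "(\<Sum>nu\<in>B. emb (of_bool (la = nu)) * t nu) = t la"
    using finite_B by (simp add: of_bool_def if_distrib[where f = "\<lambda>x. emb x * _"] cong: if_cong)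
  moreover have "retract_poly m (t la) = t la"
    using t_carrier[OF la] by (simp add: carrier_Sq_iff)
  ultimately show "retract_poly m (t la) - (\<Sum>nu\<in>B. emb (of_bool (la = nu)) * t nu) \<in> I"
    using I_0 by simp
qed

lemma sigma_part_in_carrier: "[:sigma_part m la:] \<in> carrier (Sq m)"
  by (simp add: carrier_Sq_iff poly_eq_iff coeff_pCons retract_sigma_part split: nat.split)

text \<open>Applying \<open>Scale2\<close> to the expansion with coordinates f and comparing gives
  2^|la| f_mu(q) = 2^|mu| f_mu(2^n q). A non-zero coefficient of q^i therefore forces 2^|la| =
  2^(|mu| + n i).\<close>

lemma coords_sigma_part_homogeneous:
  assumes "mu \<in> B" and nz: "poly.coeff (coords [:sigma_part m la:] mu) i \<noteq> 0"
  shows "sum_list la = sum_list mu + n * i"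
proof -
  let ?x = "[:sigma_part m la:]"
  let ?f = "coords ?x"
  have x: "retract_poly m ?x = ?x"
    using sigma_part_in_carrier by (simp add: carrier_Sq_iff)
  have Sx: "Scale2 n ?x = emb [:2 ^ sum_list la:] * ?x"
    by (simp add: Scale2_const scale2_sigma_part emb_const)
  have "Scale2 n (?x - (\<Sum>nu\<in>B. emb (?f nu) * t nu)) \<in> I"
    using I_Scale2[OF coords_spec[of ?x]] x by simp
  also have "Scale2 n (?x - (\<Sum>nu\<in>B. emb (?f nu) * t nu)) = emb [:2 ^ sum_list la:] * ?x -
      (\<Sum>nu\<in>B. emb ((?f nu \<circ>\<^sub>p [:0, 2 ^ n:]) * [:2 ^ sum_list nu:]) * t nu)"
    by (simp only: Scale2.hom_minus Scale2.hom_sum Scale2.hom_mult Sx Scale2_emb t_Scale2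
        const_c_poly.hom_mult mult.assoc cong: sum.cong)
  finally have F: "emb [:2 ^ sum_list la:] * ?x -
      (\<Sum>nu\<in>B. emb ((?f nu \<circ>\<^sub>p [:0, 2 ^ n:]) * [:2 ^ sum_list nu:]) * t nu) \<in> I" .
  have "retract_poly m (emb [:2 ^ sum_list la:] * ?x) = emb [:2 ^ sum_list la:] * ?x"
    by (simp only: retract_poly.hom_mult retract_emb x)
  with F have "retract_poly m (emb [:2 ^ sum_list la:] * ?x) -
      (\<Sum>nu\<in>B. emb ((?f nu \<circ>\<^sub>p [:0, 2 ^ n:]) * [:2 ^ sum_list nu:]) * t nu) \<in> I"
    by (simp only:)
  from coords_eqI[OF this assms(1)]
  have "coords (emb [:2 ^ sum_list la:] * ?x) mu = (?f mu \<circ>\<^sub>p [:0, 2 ^ n:]) * [:2 ^ sum_list mu:]" .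
  then have "[:2 ^ sum_list la:] * ?f mu = [:2 ^ sum_list mu:] * (?f mu \<circ>\<^sub>p [:0, 2 ^ n:])"
    by (simp only: coords_emb) (simp only: mult.commute)
  then have "poly.coeff ([:2 ^ sum_list la:] * ?f mu) i = poly.coeff ([:2 ^ sum_list mu:] * (?f mu \<circ>\<^sub>p [:0, 2 ^ n:])) i"
    by simp
  then have "2 ^ sum_list la * poly.coeff (?f mu) i = 2 ^ sum_list mu * ((2 ^ n) ^ i * poly.coeff (?f mu) i)"
    by (simp add: coeff_pcompose_linear)
  then have "(2 :: rat) ^ sum_list la = 2 ^ (sum_list mu + n * i)"
    using nz by (simp add: power_add power_mult)
  then show ?thesis
    by simp
qed

text \<open>Condition (2), read modulo q.\<close>

lemma coords_sigma_part_coeff_0: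
  assumes "la \<in> B" and "mu \<in> B"
  shows "poly.coeff (coords [:sigma_part m la:] mu) 0 = of_bool (la = mu)"
proof -
  obtain w where "t la - [:sigma_part m la:] - emb [:0, 1:] * w \<in> I"
    using t_sigma[OF assms(1)] by blast
  then have "coords (t la - [:sigma_part m la:] - emb [:0, 1:] * w) mu = 0"
    by (intro coords_I) (simp add: retract_I)
  then have "coords (t la) mu - coords [:sigma_part m la:] mu - [:0, 1:] * coords w mu = 0"
    by (simp only: coords_diff coords_emb)
  then have "poly.coeff (coords (t la) mu - coords [:sigma_part m la:] mu - [:0, 1:] * coords w mu) 0 = 0"
    by (simp only: coeff_0)
  then show ?thesis
    using assms by (cases "la = mu") (simp_all add: coords_t)
qed

text \<open>The last generator of the ideal makes \<sigma>_n equal to - (-1)^m \<alpha> q in the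
  quotient, whence the value given to \<open>\<theta>\<close>.\<close>

lemma positive_deformation:
  "positive_deformation m (\<lambda>i. [:c_gen m (int i):]) (\<lambda>x. [:sigma m x:]) k n (- ((-1) ^ m * \<alpha>)) emb
     (\<lambda>a. t (unpad a)) (\<lambda>x a. coords x (unpad a))"
proof unfold_locales
  show "[:c_gen m (int 0):] = 1"
    by (simp add: c_gen_def)
  show "[:sigma m 0:] = 1"
    by (simp add: sigma_0)
  show "[:sigma m x:] = 0" if "x < 0" for x
    using that by (simp add: sigma_neg)
  show "(\<Sum>i\<le>m. (-1) ^ i * [:c_gen m (int i):] * [:sigma m (x - int i):]) = 0" if "x \<ge> 1" for x
  proof -
    have "(\<Sum>i\<le>m. (-1) ^ i * [:c_gen m (int i):] * [:sigma m (x - int i):]) =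
        [:\<Sum>i\<le>m. (-1) ^ i * c_gen m (int i) * sigma m (x - int i):]"
      by (simp add: const_poly.hom_sum const_poly.hom_mult const_poly.hom_power const_poly.hom_uminus
          del: mult_pCons_left mult_pCons_right)
    with sigma_recursion[OF that] show ?thesis
      by simp
  qed
  show "m \<ge> 1" "k \<ge> 1" "n = m + k"
    using m_pos m_less k_eq by auto
  show "coords (x + y) (unpad \<nu>) = coords x (unpad \<nu>) + coords y (unpad \<nu>)" for x y \<nu>
    by (rule coords_add)
  show "coords (emb f * x) (unpad \<nu>) = f * coords x (unpad \<nu>)" for f x \<nu>
    by (rule coords_emb)
  show "coords (t (unpad \<mu>)) (unpad \<nu>) = of_bool (\<mu> = \<nu>)"
    if "\<mu> \<in> box_funs m k" "\<nu> \<in> box_funs m k" for \<mu> \<nu>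
  proof -
    have "unpad \<mu> = unpad \<nu> \<longleftrightarrow> \<mu> = \<nu>"
      using pad_unpad that by metis
    with that show ?thesis
      by (simp add: coords_t unpad_in_box_partitions)
  qed
  show "coords (x * y) (unpad \<nu>) = 0"
    if "\<And>\<nu>. \<nu> \<in> box_funs m k \<Longrightarrow> coords x (unpad \<nu>) = 0" "\<nu> \<in> box_funs m k" for x y \<nu>
  proof -
    have "\<forall>la\<in>B. coords x la = 0"
      using that(1) pad_in_box_funs unpad_pad by metis
    then have "retract_poly m x \<in> I"
      by (simp add: coords_0_iff)
    from I_mult[OF this retract_poly_in_carrier[of m y]] show ?thesis
      by (intro coords_I) (simp add: retract_poly.hom_mult mult.commute)
  qed
  show "coords [:sigma m j:] (unpad \<nu>) = 0" if "int k < j" "j < int n" "\<nu> \<in> box_funs m k" for j \<nu>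
  proof -
    have "[:sigma m (int (nat j)):] \<in> I"
      using that k_eq by (intro I_sigma) auto
    then show ?thesis
      using coords_mult_I[of "[:sigma m j:]" 1] that by simp
  qed
  show "coords ([:sigma m (int n):] * y) (unpad \<nu>) = [:0, - ((-1) ^ m * \<alpha>):] * coords y (unpad \<nu>)" for y \<nu>
  proof -
    have "coords (([:sigma m (int n):] + emb [:0, (-1) ^ m * \<alpha>:]) * y) (unpad \<nu>) = 0"
      using I_sigma_n unfolding monom_eq_emb by (rule coords_mult_I)
    then have "coords ([:sigma m (int n):] * y) (unpad \<nu>) + [:0, (-1) ^ m * \<alpha>:] * coords y (unpad \<nu>) = 0"
      by (simp only: distrib_right coords_add coords_emb)
    then have "coords ([:sigma m (int n):] * y) (unpad \<nu>) = - ([:0, (-1) ^ m * \<alpha>:] * coords y (unpad \<nu>))"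
      by (simp only: eq_neg_iff_add_eq_0)
    then show ?thesis
      by simp
  qed
  show "poly.coeff (coords (t (unpad \<kappa>) * t (unpad \<mu>)) (unpad \<nu>)) i \<ge> 0"
    if "\<kappa> \<in> box_funs m k" "\<mu> \<in> box_funs m k" "\<nu> \<in> box_funs m k" for \<kappa> \<mu> \<nu> i
  proof -
    have B: "unpad \<kappa> \<in> B" "unpad \<mu> \<in> B"
      using that by (simp_all add: unpad_in_box_partitions)
    obtain g where g: "\<forall>nu i. poly.coeff (g nu) i \<ge> 0"
      "t (unpad \<kappa>) * t (unpad \<mu>) - (\<Sum>nu\<in>B. emb (g nu) * t nu) \<in> I"
      using t_mult[OF B] by blast
    have "t (unpad \<kappa>) * t (unpad \<mu>) \<in> carrier (Sq m)"
      using that by (intro carrier_Sq_closed t_carrier unpad_in_box_partitions)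
    then have "coords (t (unpad \<kappa>) * t (unpad \<mu>)) (unpad \<nu>) = g (unpad \<nu>)"
      using g(2) that by (intro coords_eqI unpad_in_box_partitions) (simp_all add: carrier_Sq_iff)
    with g(1) show ?thesis
      by simp
  qed
  fix \<mu> \<nu> :: "nat \<Rightarrow> nat"
  assume P: "\<mu> \<in> box_funs m k" "\<nu> \<in> box_funs m k"
  have s: "jt_det (\<lambda>x. [:sigma m x:]) m (\<lambda>i. int (\<mu> i)) = [:sigma_part m (unpad \<mu>):]"
    using sigma_part_pad[OF unpad_in_box_partitions[OF P(1)]] by (simp add: pad_unpad[OF P(1)])
  show "(\<Sum>i<m. \<mu> i) = (\<Sum>i<m. \<nu> i) + n * i"
    if "poly.coeff (coords (jt_det (\<lambda>x. [:sigma m x:]) m (\<lambda>i. int (\<mu> i))) (unpad \<nu>)) i \<noteq> 0" for i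
    using coords_sigma_part_homogeneous[OF unpad_in_box_partitions[OF P(2)], of "unpad \<mu>" i] that
      sum_pad[OF unpad_in_box_partitions[OF P(1)]] sum_pad[OF unpad_in_box_partitions[OF P(2)]]
    by (simp add: s pad_unpad[OF P(1)] pad_unpad[OF P(2)])
  have "unpad \<mu> = unpad \<nu> \<longleftrightarrow> \<mu> = \<nu>"
    using pad_unpad P by metis
  then show "poly.coeff (coords (jt_det (\<lambda>x. [:sigma m x:]) m (\<lambda>i. int (\<mu> i))) (unpad \<nu>)) 0 = of_bool (\<mu> = \<nu>)"
    using P by (simp add: s coords_sigma_part_coeff_0 unpad_in_box_partitions)
qed

theorem t_eq_sigma_part:
  assumes "la \<in> B"
  shows "t la - [:sigma_part m la:] \<in> I"
proof -
  interpret positive_deformation m "\<lambda>i. [:c_gen m (int i):]" "\<lambda>x. [:sigma m x:]" k n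
    "- ((-1) ^ m * \<alpha>)" emb "\<lambda>a. t (unpad a)" "\<lambda>x a. coords x (unpad a)"
    by (rule positive_deformation)
  have "coords [:sigma_part m la:] mu = of_bool (la = mu)" if "mu \<in> B" for mu
  proof -
    have "pad la = pad mu \<longleftrightarrow> la = mu"
      using unpad_pad assms that by metis
    then show ?thesis
      using crd_s[OF pad_in_box_funs[OF assms] pad_in_box_funs[OF that]]
      by (simp add: unpad_pad[OF that] sigma_part_pad[OF assms])
  qed
  then have "\<forall>mu\<in>B. coords (t la - [:sigma_part m la:]) mu = 0"
    using assms by (simp add: coords_diff coords_t)
  moreover have "t la - [:sigma_part m la:] \<in> carrier (Sq m)"
    using assms by (intro carrier_Sq_closed t_carrier sigma_part_in_carrier)
  ultimately show ?thesis
    by (simp add: coords_0_iff carrier_Sq_iff)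
qed

end

section \<open>The quotient ring\<close>

lemma Sq_simps [simp]:
  "monoid.mult (Sq m) = (*)" "add (Sq m) = (+)" "one (Sq m) = 1" "zero (Sq m) = 0"
  by (simp_all add: Sq_def)

lemma cring_Sq: "cring (Sq m)"
proof (rule cringI)
  show "abelian_group (Sq m)"
  proof (rule abelian_groupI)
    fix x assume "x \<in> carrier (Sq m)"
    then show "\<exists>y\<in>carrier (Sq m). y \<oplus>\<^bsub>Sq m\<^esub> x = \<zero>\<^bsub>Sq m\<^esub>"
      by (intro bexI[of _ "- x"]) (auto intro: carrier_Sq_closed)
  qed (auto intro: carrier_Sq_closed)
  show "comm_monoid (Sq m)"
    by (rule comm_monoidI) (auto intro: carrier_Sq_closed)
qed (simp add: distrib_right)

lemma minus_Sq: "x \<in> carrier (Sq m) \<Longrightarrow> y \<in> carrier (Sq m) \<Longrightarrow> x \<ominus>\<^bsub>Sq m\<^esub> y = x - y"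
proof -
  interpret cring "Sq m"
    by (rule cring_Sq)
  assume y: "y \<in> carrier (Sq m)"
  have "\<ominus>\<^bsub>Sq m\<^esub> y = - y"
    by (rule minus_equality) (use y in \<open>auto intro: carrier_Sq_closed\<close>)
  then show ?thesis
    by (simp add: a_minus_def)
qed

definition QH_generators :: "nat \<Rightarrow> nat \<Rightarrow> rat \<Rightarrow> cpoly poly set" where
  "QH_generators m n \<alpha> = {[:sigma m (int p):] | p. n - m + 1 \<le> p \<and> p \<le> n - 1}
    \<union> {[:sigma m (int n):] + Polynomial.monom ((-1) ^ m * const_c \<alpha>) 1}"

lemma QH_ideal_eq: "QH_ideal m n \<alpha> = Idl\<^bsub>Sq m\<^esub> (QH_generators m n \<alpha>)"
  by (simp add: QH_ideal_def QH_generators_def)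

lemma QH_generators_carrier: "QH_generators m n \<alpha> \<subseteq> carrier (Sq m)"
  unfolding QH_generators_def monom_eq_emb
  by (auto intro: carrier_Sq_closed const_sigma_in_carrier emb_in_carrier)

lemma ideal_QH_ideal: "ideal (QH_ideal m n \<alpha>) (Sq m)"
  unfolding QH_ideal_eq
  by (rule ring.genideal_ideal[OF cring.axioms(1)[OF cring_Sq] QH_generators_carrier])

lemma QH_ideal_closed:
  "QH_ideal m n \<alpha> \<subseteq> carrier (Sq m)" "0 \<in> QH_ideal m n \<alpha>"
  "x \<in> QH_ideal m n \<alpha> \<Longrightarrow> y \<in> QH_ideal m n \<alpha> \<Longrightarrow> x + y \<in> QH_ideal m n \<alpha>"
  "x \<in> QH_ideal m n \<alpha> \<Longrightarrow> z \<in> carrier (Sq m) \<Longrightarrow> z * x \<in> QH_ideal m n \<alpha>"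
  "x \<in> QH_ideal m n \<alpha> \<Longrightarrow> z \<in> carrier (Sq m) \<Longrightarrow> x * z \<in> QH_ideal m n \<alpha>"
  "x \<in> QH_ideal m n \<alpha> \<Longrightarrow> - x \<in> QH_ideal m n \<alpha>"
proof -
  interpret ideal "QH_ideal m n \<alpha>" "Sq m"
    by (rule ideal_QH_ideal)
  show "QH_ideal m n \<alpha> \<subseteq> carrier (Sq m)" "0 \<in> QH_ideal m n \<alpha>"
    "x \<in> QH_ideal m n \<alpha> \<Longrightarrow> y \<in> QH_ideal m n \<alpha> \<Longrightarrow> x + y \<in> QH_ideal m n \<alpha>"
    and l: "\<And>z. x \<in> QH_ideal m n \<alpha> \<Longrightarrow> z \<in> carrier (Sq m) \<Longrightarrow> z * x \<in> QH_ideal m n \<alpha>"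
    using Icarr I_l_closed additive_subgroup.zero_closed[OF ideal.axioms(1)[OF ideal_QH_ideal], of m n \<alpha>]
      additive_subgroup.a_closed[OF ideal.axioms(1)[OF ideal_QH_ideal], of x m n \<alpha> y] by auto
  show "x \<in> QH_ideal m n \<alpha> \<Longrightarrow> z \<in> carrier (Sq m) \<Longrightarrow> x * z \<in> QH_ideal m n \<alpha>"
    using l[of z] by (simp only: mult.commute[of x z])
  show "x \<in> QH_ideal m n \<alpha> \<Longrightarrow> - x \<in> QH_ideal m n \<alpha>"
    using l[of "- 1"] carrier_Sq_closed(3)[OF carrier_Sq_closed(2)] by simp
qed

lemma QH_ideal_generators: "QH_generators m n \<alpha> \<subseteq> QH_ideal m n \<alpha>"
  unfolding QH_ideal_eq
  by (rule ring.genideal_self[OF cring.axioms(1)[OF cring_Sq] QH_generators_carrier])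

text \<open>The preimage of the ideal under \<open>Scale2\<close> is an ideal containing the
  generators, because each generator is an eigenvector; both terms of the last one have degree
  \<open>n\<close>.\<close>

lemma QH_ideal_Scale2:
  assumes "x \<in> QH_ideal m n \<alpha>"
  shows "Scale2 n x \<in> QH_ideal m n \<alpha>"
proof -
  interpret cring "Sq m"
    by (rule cring_Sq)
  let ?J = "{x \<in> carrier (Sq m). Scale2 n x \<in> QH_ideal m n \<alpha>}"
  have "ideal ?J (Sq m)"
  proof (rule idealI)
    show "subgroup ?J (add_monoid (Sq m))"
    proof (rule group.subgroupI)
      show "group (add_monoid (Sq m))"
        by (rule add.is_group)
      show "?J \<noteq> {}"
        using QH_ideal_closed(2) carrier_Sq_closed(1) by (auto intro!: exI[of _ 0])
      fix x assume x: "x \<in> ?J"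
      have "inv\<^bsub>add_monoid (Sq m)\<^esub> x = - x"
        using x minus_equality[of "- x" x] by (auto simp: a_inv_def intro: carrier_Sq_closed)
      with x show "inv\<^bsub>add_monoid (Sq m)\<^esub> x \<in> ?J"
        by (auto simp: Scale2.hom_uminus intro: QH_ideal_closed carrier_Sq_closed)
    qed (auto simp: Scale2.hom_add intro: QH_ideal_closed carrier_Sq_closed)
  qed (auto simp: Scale2.hom_mult
      intro: QH_ideal_closed carrier_Sq_closed Scale2_in_carrier ring_axioms)
  moreover have "QH_generators m n \<alpha> \<subseteq> ?J"
  proof
    fix x assume x: "x \<in> QH_generators m n \<alpha>"
    have "Scale2 n x \<in> QH_ideal m n \<alpha>"
    proof -
      obtain r where "Scale2 n x = emb r * x"
      proof (cases "\<exists>p. x = [:sigma m (int p):]")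
        case True
        then obtain p where "x = [:sigma m (int p):]"
          by blast
        then have "Scale2 n x = emb [:2 ^ p:] * x"
          by (simp add: Scale2_const scale2_sigma emb_const)
        then show ?thesis
          by (rule that)
      next
        case False
        then have *: "x = [:sigma m (int n):] + emb [:0, (-1) ^ m * \<alpha>:]"
          using x unfolding QH_generators_def monom_eq_emb by blast
        have "[:0, (-1) ^ m * \<alpha>:] \<circ>\<^sub>p [:0, 2 ^ n:] = [:2 ^ n:] * [:0, (-1) ^ m * \<alpha>:]"
          by (simp add: pcompose_pCons)
        then have "Scale2 n x = emb [:2 ^ n:] * x"
          unfolding * Scale2.hom_add Scale2_emb Scale2_const scale2_sigma distrib_left
          by (simp only: const_c_poly.hom_mult) (simp add: emb_const)
        then show ?thesis
          by (rule that)
      qed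
      moreover have "emb r * x \<in> QH_ideal m n \<alpha>"
        using x QH_ideal_generators emb_in_carrier by (intro QH_ideal_closed(4)) auto
      ultimately show ?thesis
        by simp
    qed
    then show "x \<in> ?J"
      using x QH_generators_carrier by blast
  qed
  ultimately have "QH_ideal m n \<alpha> \<subseteq> ?J"
    unfolding QH_ideal_eq by (rule genideal_minimal)
  with assms show ?thesis
    by blast
qed

abbreviation QH_ring :: "nat \<Rightarrow> nat \<Rightarrow> rat \<Rightarrow> cpoly poly set ring" where
  "QH_ring m n \<alpha> \<equiv> Sq m Quot QH_ideal m n \<alpha>"

lemma QH_simps:
  "carrier (QH m n \<alpha>) = carrier (QH_ring m n \<alpha>)"
  "monoid.mult (QH m n \<alpha>) = monoid.mult (QH_ring m n \<alpha>)"
  "add (QH m n \<alpha>) = add (QH_ring m n \<alpha>)"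
  "one (QH m n \<alpha>) = one (QH_ring m n \<alpha>)"
  "zero (QH m n \<alpha>) = zero (QH_ring m n \<alpha>)"
  "f \<odot>\<^bsub>QH m n \<alpha>\<^esub> x = QH_class m n \<alpha> (emb f) \<otimes>\<^bsub>QH m n \<alpha>\<^esub> x"
  by (simp_all add: QH_def ring.defs module.defs)

lemma cring_QH_ring: "cring (QH_ring m n \<alpha>)"
  by (rule ideal.quotient_is_cring[OF ideal_QH_ideal cring_Sq])

lemma cring_QH: "cring (QH m n \<alpha>)"
proof -
  interpret Q: cring "QH_ring m n \<alpha>"
    by (rule cring_QH_ring)
  show ?thesis
  proof (rule cringI)
    show "abelian_group (QH m n \<alpha>)"
    proof (rule abelian_groupI)
      fix x assume "x \<in> carrier (QH m n \<alpha>)"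
      then show "\<exists>y\<in>carrier (QH m n \<alpha>). y \<oplus>\<^bsub>QH m n \<alpha>\<^esub> x = \<zero>\<^bsub>QH m n \<alpha>\<^esub>"
        unfolding QH_simps by (intro bexI[of _ "\<ominus>\<^bsub>QH_ring m n \<alpha>\<^esub> x"]) (simp_all add: Q.l_neg)
    qed (auto simp: QH_simps Q.a_ac)
    show "comm_monoid (QH m n \<alpha>)"
      by (rule comm_monoidI) (auto simp: QH_simps Q.m_ac)
  qed (auto simp: QH_simps Q.l_distr)
qed

lemma QH_class_hom: "QH_class m n \<alpha> \<in> ring_hom (Sq m) (QH m n \<alpha>)"
proof -
  have "QH_class m n \<alpha> = (+>\<^bsub>Sq m\<^esub>) (QH_ideal m n \<alpha>)"
    by (simp add: QH_class_def fun_eq_iff)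
  with ideal.rcos_ring_hom[OF ideal_QH_ideal, of m n \<alpha>] show ?thesis
    by (simp add: ring_hom_def QH_simps)
qed

lemma QH_class_eq_iff:
  "x \<in> carrier (Sq m) \<Longrightarrow> y \<in> carrier (Sq m) \<Longrightarrow>
     QH_class m n \<alpha> x = QH_class m n \<alpha> y \<longleftrightarrow> x - y \<in> QH_ideal m n \<alpha>"
  using ring.quotient_eq_iff_same_a_r_cos[OF cring.axioms(1)[OF cring_Sq] ideal_QH_ideal, of x m y n \<alpha>]
  by (simp add: QH_class_def minus_Sq)

lemma QH_class_0: "\<zero>\<^bsub>QH m n \<alpha>\<^esub> = QH_class m n \<alpha> 0"
  using ring_hom_zero[OF QH_class_hom cring.axioms(1)[OF cring_Sq] cring.axioms(1)[OF cring_QH], of m n \<alpha>] by simp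

lemma QH_finsum:
  assumes "finite A" and "\<And>i. i \<in> A \<Longrightarrow> g i \<in> carrier (Sq m)"
  shows "(\<Oplus>\<^bsub>QH m n \<alpha>\<^esub>i\<in>A. f i \<odot>\<^bsub>QH m n \<alpha>\<^esub> QH_class m n \<alpha> (g i)) =
    QH_class m n \<alpha> (\<Sum>i\<in>A. emb (f i) * g i)"
  using assms
proof (induction A)
  interpret Q: cring "QH m n \<alpha>"
    by (rule cring_QH)
  note hom = ring_hom_closed[OF QH_class_hom] ring_hom_mult[OF QH_class_hom] ring_hom_add[OF QH_class_hom]
  {
    case empty
    show ?case
      by (simp add: QH_class_0)
  next
    case (insert a A)
    have 1: "f i \<odot>\<^bsub>QH m n \<alpha>\<^esub> QH_class m n \<alpha> (g i) = QH_class m n \<alpha> (emb (f i) * g i)"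
      if "i \<in> insert a A" for i
      using hom(2)[OF emb_in_carrier insert.prems[OF that]] by (simp add: QH_simps(6))
    have 2: "emb (f i) * g i \<in> carrier (Sq m)" if "i \<in> insert a A" for i
      using insert.prems[OF that] by (intro carrier_Sq_closed emb_in_carrier)
    have "(\<Oplus>\<^bsub>QH m n \<alpha>\<^esub>i\<in>insert a A. f i \<odot>\<^bsub>QH m n \<alpha>\<^esub> QH_class m n \<alpha> (g i)) =
      f a \<odot>\<^bsub>QH m n \<alpha>\<^esub> QH_class m n \<alpha> (g a) \<oplus>\<^bsub>QH m n \<alpha>\<^esub>
      (\<Oplus>\<^bsub>QH m n \<alpha>\<^esub>i\<in>A. f i \<odot>\<^bsub>QH m n \<alpha>\<^esub> QH_class m n \<alpha> (g i))"
      using insert.hyps 1 2 by (intro Q.finsum_insert) (simp_all add: Pi_iff hom(1))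
    also have "\<dots> = QH_class m n \<alpha> (emb (f a) * g a) \<oplus>\<^bsub>QH m n \<alpha>\<^esub> QH_class m n \<alpha> (\<Sum>i\<in>A. emb (f i) * g i)"
      using insert 1 by simp
    also have "\<dots> = QH_class m n \<alpha> (emb (f a) * g a + (\<Sum>i\<in>A. emb (f i) * g i))"
      using hom(3)[of "emb (f a) * g a" m "\<Sum>i\<in>A. emb (f i) * g i" n \<alpha>] 2 by (simp add: carrier_Sq_sum)
    finally show ?case
      using insert.hyps by simp
  }
qed

theorem theorem18:
  fixes m n k :: nat and \<alpha> :: rat
    and \<tau> :: "nat list \<Rightarrow> cpoly poly set"
    and N :: "nat list \<Rightarrow> nat list \<Rightarrow> nat list \<Rightarrow> nat \<Rightarrow> rat"
  assumes "1 \<le> m" and "m < n" and "k = n - m"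
    and "is_finite_basis (QH m n \<alpha>) (box_partitions m k) \<tau>"
    and "\<And>la. la \<in> box_partitions m k \<Longrightarrow> QH_homogeneous m n \<alpha> (sum_list la) (\<tau> la)"
    and "\<And>la. la \<in> box_partitions m k \<Longrightarrow>
           \<tau> la \<ominus>\<^bsub>QH m n \<alpha>\<^esub> QH_sigma m n \<alpha> la \<in> Idl\<^bsub>QH m n \<alpha>\<^esub> {QH_q m n \<alpha>}"
    and "is_structure_constants (QH m n \<alpha>) (box_partitions m k) \<tau> N"
    and "\<And>la mu nu d. la \<in> box_partitions m k \<Longrightarrow> mu \<in> box_partitions m k \<Longrightarrow>
           nu \<in> box_partitions m k \<Longrightarrow> N la mu nu d \<ge> 0"
  shows "\<forall>la \<in> box_partitions m k. \<tau> la = QH_sigma m n \<alpha> la"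
proof -
  let ?B = "box_partitions m k" and ?I = "QH_ideal m n \<alpha>" and ?c = "QH_class m n \<alpha>" and ?C = "carrier (Sq m)"
  interpret Q: cring "QH m n \<alpha>"
    by (rule cring_QH)
  note hom = ring_hom_closed[OF QH_class_hom] ring_hom_mult[OF QH_class_hom] ring_hom_add[OF QH_class_hom]
  have finB: "finite ?B"
    using assms(4) by (simp add: is_finite_basis_def)
  \<comment> \<open>Homogeneous representatives satisfy the eigenvector equation in S[q] itself, not
    only modulo the ideal.\<close>
  have "\<forall>la\<in>?B. \<exists>P. P \<in> ?C \<and> Sq_homogeneous n (sum_list la) P \<and> \<tau> la = ?c P"
    using assms(5) by (auto simp: QH_homogeneous_def)
  then obtain t where t: "\<And>la. la \<in> ?B \<Longrightarrow> t la \<in> ?C"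
    "\<And>la. la \<in> ?B \<Longrightarrow> Sq_homogeneous n (sum_list la) (t la)" "\<And>la. la \<in> ?B \<Longrightarrow> \<tau> la = ?c (t la)"
    by metis
  have emb_t: "emb f * t la \<in> ?C" if "la \<in> ?B" for f la
    using t(1)[OF that] by (intro carrier_Sq_closed emb_in_carrier)
  have finsum: "(\<Oplus>\<^bsub>QH m n \<alpha>\<^esub>la\<in>?B. f la \<odot>\<^bsub>QH m n \<alpha>\<^esub> \<tau> la) = ?c (\<Sum>la\<in>?B. emb (f la) * t la)" for f
  proof -
    have "(\<Oplus>\<^bsub>QH m n \<alpha>\<^esub>la\<in>?B. f la \<odot>\<^bsub>QH m n \<alpha>\<^esub> \<tau> la) = (\<Oplus>\<^bsub>QH m n \<alpha>\<^esub>la\<in>?B. f la \<odot>\<^bsub>QH m n \<alpha>\<^esub> ?c (t la))"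
      using hom(2)[OF emb_in_carrier t(1)]
      by (intro Q.finsum_cong') (auto simp: t(3) QH_simps(6) intro!: Q.m_closed hom(1) emb_in_carrier t(1))
    also have "\<dots> = ?c (\<Sum>la\<in>?B. emb (f la) * t la)"
      by (rule QH_finsum[OF finB t(1)])
    finally show ?thesis .
  qed
  have sigma_carrier: "[:sigma_part m la:] \<in> ?C" for la
    by (simp add: carrier_Sq_iff poly_eq_iff coeff_pCons retract_sigma_part split: nat.split)
  interpret qh_representatives m n k \<alpha> ?I t
  proof
    show "\<exists>f. x - (\<Sum>la\<in>?B. emb (f la) * t la) \<in> ?I" if x: "x \<in> ?C" for x
    proof -
      have "\<forall>x\<in>carrier (QH m n \<alpha>). \<exists>f. x = (\<Oplus>\<^bsub>QH m n \<alpha>\<^esub>la\<in>?B. f la \<odot>\<^bsub>QH m n \<alpha>\<^esub> \<tau> la)"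
        using assms(4) unfolding is_finite_basis_def by (elim conjE)
      from bspec[OF this hom(1)[OF x]]
      obtain f where "?c x = (\<Oplus>\<^bsub>QH m n \<alpha>\<^esub>la\<in>?B. f la \<odot>\<^bsub>QH m n \<alpha>\<^esub> \<tau> la)"
        by (elim exE)
      then have "x - (\<Sum>la\<in>?B. emb (f la) * t la) \<in> ?I"
        using x emb_t by (simp add: finsum QH_class_eq_iff carrier_Sq_sum)
      then show ?thesis
        by (rule exI[of _ f])
    qed
    show "f la = 0" if "(\<Sum>la\<in>?B. emb (f la) * t la) \<in> ?I" "la \<in> ?B" for f la
    proof -
      have "?c (\<Sum>la\<in>?B. emb (f la) * t la) = ?c 0"
        using that emb_t by (subst QH_class_eq_iff) (auto intro: carrier_Sq_sum carrier_Sq_closed)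
      moreover have "\<forall>f. (\<Oplus>\<^bsub>QH m n \<alpha>\<^esub>la\<in>?B. f la \<odot>\<^bsub>QH m n \<alpha>\<^esub> \<tau> la) = \<zero>\<^bsub>QH m n \<alpha>\<^esub> \<longrightarrow> (\<forall>la\<in>?B. f la = 0)"
        using assms(4) unfolding is_finite_basis_def by (elim conjE)
      ultimately have "\<forall>la\<in>?B. f la = 0"
        unfolding finsum QH_class_0 by (elim allE[of _ f]) simp
      with that(2) show ?thesis
        by simp
    qed
    show "\<exists>w\<in>?C. t la - [:sigma_part m la:] - emb [:0, 1:] * w \<in> ?I" if la: "la \<in> ?B" for la
    proof -
      define u where "u = emb [:0, 1:]"
      have u: "u \<in> ?C"
        unfolding u_def by (rule emb_in_carrier)
      have "Polynomial.monom 1 1 = u"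
        by (auto simp: u_def poly_eq_iff coeff_pCons split: nat.split)
      then have q: "QH_q m n \<alpha> = ?c u"
        by (simp add: QH_q_def)
      \<comment> \<open>In a commutative ring the ideal generated by q consists of the multiples of
        q, and the multiplier is the class of some \<open>w\<close> in S[q].\<close>
      have "\<tau> la \<ominus>\<^bsub>QH m n \<alpha>\<^esub> QH_sigma m n \<alpha> la \<in> PIdl\<^bsub>QH m n \<alpha>\<^esub> (?c u)"
        using assms(6)[OF la] by (simp only: q Q.cgenideal_eq_genideal[OF hom(1)[OF u]])
      then obtain x where x: "x \<in> carrier (QH m n \<alpha>)"
        "?c (t la) \<ominus>\<^bsub>QH m n \<alpha>\<^esub> ?c [:sigma_part m la:] = x \<otimes>\<^bsub>QH m n \<alpha>\<^esub> ?c u"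
        unfolding cgenideal_def t(3)[OF la] QH_sigma_def by blast
      obtain w where w: "w \<in> ?C" "x = ?c w"
        using x(1) by (auto simp: QH_simps FactRing_def A_RCOSETS_def' QH_class_def)
      have c: "?c (t la) \<in> carrier (QH m n \<alpha>)" "?c [:sigma_part m la:] \<in> carrier (QH m n \<alpha>)"
        using hom(1) t(1)[OF la] sigma_carrier by auto
      have wu: "w * u \<in> ?C"
        using w(1) u by (rule carrier_Sq_closed)
      have "?c (t la) = (?c (t la) \<ominus>\<^bsub>QH m n \<alpha>\<^esub> ?c [:sigma_part m la:]) \<oplus>\<^bsub>QH m n \<alpha>\<^esub> ?c [:sigma_part m la:]"
        using c by (simp add: Q.minus_eq Q.a_assoc Q.l_neg)
      also have "\<dots> = ?c (w * u) \<oplus>\<^bsub>QH m n \<alpha>\<^esub> ?c [:sigma_part m la:]"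
        using hom(2)[OF w(1) u] by (simp only: x(2) w(2) Sq_simps)
      also have "\<dots> = ?c (w * u + [:sigma_part m la:])"
        using hom(3)[OF wu sigma_carrier] by (simp only: Sq_simps)
      finally have "t la - (w * u + [:sigma_part m la:]) \<in> ?I"
        using QH_class_eq_iff[OF t(1)[OF la] carrier_Sq_closed(4)[OF wu sigma_carrier]] by simp
      also have "t la - (w * u + [:sigma_part m la:]) = t la - [:sigma_part m la:] - u * w"
        by (simp only: diff_diff_eq add.commute mult.commute)
      finally show ?thesis
        using w(1) unfolding u_def by (rule bexI)
    qed
    show "\<exists>g. (\<forall>nu i. poly.coeff (g nu) i \<ge> 0) \<and> t la * t mu - (\<Sum>nu\<in>?B. emb (g nu) * t nu) \<in> ?I"
      if la: "la \<in> ?B" and mu: "mu \<in> ?B" for la mu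
    proof -
      define F where "F = {(nu, d). nu \<in> ?B \<and> N la mu nu d \<noteq> 0}"
      define f where "f p = Polynomial.monom (N la mu (fst p) (snd p)) (snd p)" for p
      have F: "finite F" "\<And>p. p \<in> F \<Longrightarrow> fst p \<in> ?B"
        and prod: "\<tau> la \<otimes>\<^bsub>QH m n \<alpha>\<^esub> \<tau> mu = (\<Oplus>\<^bsub>QH m n \<alpha>\<^esub>p\<in>F. f p \<odot>\<^bsub>QH m n \<alpha>\<^esub> \<tau> (fst p))"
        using assms(7) la mu unfolding is_structure_constants_def F_def f_def by auto
      \<comment> \<open>All powers of q that accompany the same \<open>nu\<close> are collected into
        one polynomial coefficient.\<close>
      define g where "g nu = (\<Sum>p | p \<in> F \<and> fst p = nu. f p)" for nu
      have "?c (t la * t mu) = \<tau> la \<otimes>\<^bsub>QH m n \<alpha>\<^esub> \<tau> mu"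
        using hom(2)[OF t(1)[OF la] t(1)[OF mu]] by (simp add: t(3) la mu)
      also have "\<dots> = (\<Oplus>\<^bsub>QH m n \<alpha>\<^esub>p\<in>F. f p \<odot>\<^bsub>QH m n \<alpha>\<^esub> ?c (t (fst p)))"
        unfolding prod using F hom(2)[OF emb_in_carrier t(1)]
        by (intro Q.finsum_cong') (auto simp: t(3) QH_simps(6) intro!: Q.m_closed hom(1) emb_in_carrier t(1))
      also have "\<dots> = ?c (\<Sum>p\<in>F. emb (f p) * t (fst p))"
        using F t(1) by (intro QH_finsum) auto
      also have "(\<Sum>p\<in>F. emb (f p) * t (fst p)) = (\<Sum>nu\<in>?B. \<Sum>p | p \<in> F \<and> fst p = nu. emb (f p) * t (fst p))"
        using F finB by (intro sum.group[symmetric]) auto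
      also have "\<dots> = (\<Sum>nu\<in>?B. emb (g nu) * t nu)"
        by (intro sum.cong refl) (simp add: g_def const_c_poly.hom_sum sum_distrib_right)
      finally have "t la * t mu - (\<Sum>nu\<in>?B. emb (g nu) * t nu) \<in> ?I"
        using t(1)[OF la] t(1)[OF mu] emb_t
        by (subst (asm) QH_class_eq_iff) (auto intro: carrier_Sq_closed carrier_Sq_sum)
      moreover have "poly.coeff (g nu) i \<ge> 0" for nu i
        unfolding g_def coeff_sum
        by (rule sum_nonneg) (use F(2) assms(8)[OF la mu] in \<open>auto simp: f_def\<close>)
      ultimately show ?thesis
        by blast
    qed
    show "[:sigma m (int p):] \<in> ?I" if "n - m + 1 \<le> p" "p \<le> n - 1" for p
      using that by (intro subsetD[OF QH_ideal_generators]) (auto simp: QH_generators_def)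
    show "[:sigma m (int n):] + Polynomial.monom ((-1) ^ m * const_c \<alpha>) 1 \<in> ?I"
      by (intro subsetD[OF QH_ideal_generators]) (simp add: QH_generators_def)
    show "Scale2 n (t la) = emb [:2 ^ sum_list la:] * t la" if "la \<in> ?B" for la
      by (rule Scale2_homogeneous[OF t(2)[OF that]])
  qed (use assms(1-3) t(1) in \<open>auto intro: QH_ideal_closed QH_ideal_Scale2 dest: subsetD[OF QH_ideal_closed(1)]\<close>)
  show ?thesis
    using t_eq_sigma_part t(1) sigma_carrier by (simp add: t(3) QH_sigma_def QH_class_eq_iff)
qed

end
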